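(* Functor lenses are a particular case of dependent optics, where the source bicategory $\mathcal{B}$ is a category and the $\mathcal{B}$-indexed category $\mathcal{L}$ is trivial.
   Context: A $\mathcal{B}$-indexed category, for $\mathcal{B}$ a bicategory, is a pseudofunctor $\mathcal{B}^{\mathrm{op}}\to\mathbf{Cat}$, where $\mathcal{B}^{\mathrm{op}}$ reverses 1-morphisms only. A category is regarded as a bicategory with only identity 2-morphisms. The trivial $\mathcal{B}$-indexed category is the terminal one, whose value at every object of $\mathcal{B}$ is the terminal category. Functor lenses (in the sense of Spivak): for a category $\mathcal{B}$ and a $\mathcal{B}$-indexed category $\mathcal{R}$, the category $\mathbf{Lens}_{\mathcal{R}}$ of functor lenses is the Grothendieck construction of the pointwise opposite $A\mapsto\mathcal{R}(A)^{\mathrm{op}}$ of $\mathcal{R}$. Explicitly, objects are pairs $(A,X')$ with $A\in\mathrm{Ob}(\mathcal{B})$, $X'\in\mathrm{Ob}(\mathcal{R}(A))$; a morphism $(A,X')\to(B,Y')$ is a pair consisting of $f\colon A\to B$ in $\mathcal{B}$ and a morphism $\mathcal{R}(f)(Y')\to X'$ in $\mathcal{R}(A)$, with the usual identities and composition. Dependent optics: let $\mathcal{B}$ be a bicategory (the source bicategory); $\mathcal{B}(A,B)$ denotes the category of 1-morphisms $A\to B$ and 2-morphisms between them. Given $\mathcal{B}$-indexed categories $\mathcal{L},\mathcal{R}$, write $\mathcal{L}^A=\mathcal{L}(A)$, $\mathcal{R}^A=\mathcal{R}(A)$, $f^*=\mathcal{L}(f)$, $f^{*'}=\mathcal{R}(f)$;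 the coherence isomorphisms of $\mathcal{L}$ are $\theta_A\colon\mathrm{Id}_{\mathcal{L}^A}\Rightarrow \mathrm{Id}_A^*$ and $\theta_{f,g}\colon f^* g^*\Rightarrow (g\circ f)^*$, and analogously $\theta'$ for $\mathcal{R}$. The category $\mathbf{Optic}_{\mathcal{L},\mathcal{R}}$ of dependent optics has objects $(X,X')^A$ with $A\in\mathrm{Ob}(\mathcal{B})$, $X\in\mathrm{Ob}(\mathcal{L}^A)$, $X'\in\mathrm{Ob}(\mathcal{R}^A)$, and morphisms $(X,X')^A\to(Y,Y')^B$ the elements of $\int^{f\in\mathcal{B}(A,B)}\mathcal{L}^A(X,f^*Y)\times\mathcal{R}^A(f^{*'}Y',X')$; the class of $(l,r)$ is denoted $\langle l|r\rangle$ and $f$ is its representative. Identities are $\langle(\theta_A)_X|(\theta_A'^{-1})_{X'}\rangle$, and composition is $\langle l_2|r_2\rangle\circ\langle l_1|r_1\rangle=\langle(\theta_{f,g})_Z\circ f^*(l_2)\circ l_1\,|\,r_1\circ f^{*'}(r_2)\circ(\theta'^{-1}_{f,g})_{Z'}\rangle$ for representatives $f$ of $\langle l_1|r_1\rangle$ and $g$ of $\langle l_2|r_2\rangle$. All coends are assumed to exist. *)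

theory Defs
  imports "HOL-Library.FuncSet"
begin

section \<open>Categories and functors\<close>

record ('o, 'm) cat =
  Obj :: "'o set"
  Arr :: "'m set"
  Dom :: "'m \<Rightarrow> 'o"
  Cod :: "'m \<Rightarrow> 'o"
  Ident :: "'o \<Rightarrow> 'm"
  Comp :: "'m \<Rightarrow> 'm \<Rightarrow> 'm"  (infixr "\<cdot>\<index>" 70)

definition Hom :: "('o, 'm) cat \<Rightarrow> 'o \<Rightarrow> 'o \<Rightarrow> 'm set" where
  "Hom C X Y = {f \<in> Arr C. Dom C f = X \<and> Cod C f = Y}"

locale category =
  fixes C :: "('o, 'm) cat" (structure)
  assumes Dom_Obj: "f \<in> Arr C \<Longrightarrow> Dom C f \<in> Obj C"
    and Cod_Obj: "f \<in> Arr C \<Longrightarrow> Cod C f \<in> Obj C"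
    and Ident_Hom: "X \<in> Obj C \<Longrightarrow> Ident C X \<in> Hom C X X"
    and Comp_Hom: "f \<in> Hom C X Y \<Longrightarrow> g \<in> Hom C Y Z \<Longrightarrow> g \<cdot> f \<in> Hom C X Z"
    and Ident_left: "f \<in> Hom C X Y \<Longrightarrow> Ident C Y \<cdot> f = f"
    and Ident_right: "f \<in> Hom C X Y \<Longrightarrow> f \<cdot> Ident C X = f"
    and Comp_assoc: "f \<in> Hom C W X \<Longrightarrow> g \<in> Hom C X Y \<Longrightarrow> h \<in> Hom C Y Z \<Longrightarrow>
      (h \<cdot> g) \<cdot> f = h \<cdot> (g \<cdot> f)"

definition inverse_arrows :: "('o, 'm) cat \<Rightarrow> 'm \<Rightarrow> 'm \<Rightarrow> bool" where
  "inverse_arrows C f g \<longleftrightarrow>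
     f \<in> Arr C \<and> g \<in> Hom C (Cod C f) (Dom C f) \<and>
     g \<cdot>\<^bsub>C\<^esub> f = Ident C (Dom C f) \<and> f \<cdot>\<^bsub>C\<^esub> g = Ident C (Cod C f)"

definition is_iso :: "('o, 'm) cat \<Rightarrow> 'm \<Rightarrow> bool" where
  "is_iso C f \<longleftrightarrow> (\<exists>g. inverse_arrows C f g)"

definition inv_arr :: "('o, 'm) cat \<Rightarrow> 'm \<Rightarrow> 'm" where
  "inv_arr C f = (THE g. inverse_arrows C f g)"

definition op_cat :: "('o, 'm) cat \<Rightarrow> ('o, 'm) cat" where
  "op_cat C = \<lparr>Obj = Obj C, Arr = Arr C, Dom = Cod C, Cod = Dom C, Ident = Ident C,
     Comp = (\<lambda>g f. f \<cdot>\<^bsub>C\<^esub> g)\<rparr>"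

definition discrete_cat :: "'o set \<Rightarrow> ('o, 'o) cat" where
  "discrete_cat S = \<lparr>Obj = S, Arr = S, Dom = (\<lambda>x. x), Cod = (\<lambda>x. x), Ident = (\<lambda>x. x),
     Comp = (\<lambda>y x. x)\<rparr>"

definition full_subcat :: "('o, 'm) cat \<Rightarrow> 'o set \<Rightarrow> ('o, 'm) cat" where
  "full_subcat C S = C\<lparr>Obj := Obj C \<inter> S, Arr := {f \<in> Arr C. Dom C f \<in> S \<and> Cod C f \<in> S}\<rparr>"

record ('o1, 'm1, 'o2, 'm2) functr =
  ObMap :: "'o1 \<Rightarrow> 'o2"
  ArMap :: "'m1 \<Rightarrow> 'm2"

locale is_functor = dom: category C + cod: category D
  for C :: "('o1, 'm1) cat" and D :: "('o2, 'm2) cat" +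
  fixes F :: "('o1, 'm1, 'o2, 'm2) functr"
  assumes ObMap_Obj: "X \<in> Obj C \<Longrightarrow> ObMap F X \<in> Obj D"
    and ArMap_Hom: "f \<in> Hom C X Y \<Longrightarrow> ArMap F f \<in> Hom D (ObMap F X) (ObMap F Y)"
    and ArMap_Ident: "X \<in> Obj C \<Longrightarrow> ArMap F (Ident C X) = Ident D (ObMap F X)"
    and ArMap_Comp: "f \<in> Hom C X Y \<Longrightarrow> g \<in> Hom C Y Z \<Longrightarrow>
      ArMap F (g \<cdot>\<^bsub>C\<^esub> f) = ArMap F g \<cdot>\<^bsub>D\<^esub> ArMap F f"

definition is_cat_iso ::
  "('o1, 'm1) cat \<Rightarrow> ('o2, 'm2) cat \<Rightarrow> ('o1, 'm1, 'o2, 'm2) functr \<Rightarrow> bool" where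
  "is_cat_iso C D F \<longleftrightarrow> is_functor C D F \<and> (\<exists>G. is_functor D C G \<and>
     (\<forall>X \<in> Obj C. ObMap G (ObMap F X) = X) \<and> (\<forall>f \<in> Arr C. ArMap G (ArMap F f) = f) \<and>
     (\<forall>X \<in> Obj D. ObMap F (ObMap G X) = X) \<and> (\<forall>f \<in> Arr D. ArMap F (ArMap G f) = f))"

section \<open>Bicategories\<close>

text \<open>
  The hom categories are packed into one category \<open>Cells\<close>, whose objects are all 1-morphisms and
  whose arrows are all 2-morphisms under vertical composition. The category of 1-morphisms from
  \<open>A\<close> to \<open>B\<close> is the full subcategory \<open>homcat\<close> below; 2-morphisms exist only between parallel
  1-morphisms. The composite of \<open>f : A \<rightarrow> B\<close> and \<open>g : B \<rightarrow> C\<close> is \<open>g \<odot> f\<close>; horizontal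
  composition of 2-morphisms is \<open>\<star>\<close>.
\<close>

record ('o, 'h, 't) bicat =
  Ob0 :: "'o set"
  Cells :: "('h, 't) cat"
  Src :: "'h \<Rightarrow> 'o"
  Trg :: "'h \<Rightarrow> 'o"
  One :: "'o \<Rightarrow> 'h"
  HComp1 :: "'h \<Rightarrow> 'h \<Rightarrow> 'h"  (infixr "\<odot>\<index>" 72)
  HComp2 :: "'t \<Rightarrow> 't \<Rightarrow> 't"  (infixr "\<star>\<index>" 72)
  Assoc :: "'h \<Rightarrow> 'h \<Rightarrow> 'h \<Rightarrow> 't"
  LUnit :: "'h \<Rightarrow> 't"
  RUnit :: "'h \<Rightarrow> 't"

definition Hom1 :: "('o, 'h, 't) bicat \<Rightarrow> 'o \<Rightarrow> 'o \<Rightarrow> 'h set" where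
  "Hom1 B X Y = {f \<in> Obj (Cells B). Src B f = X \<and> Trg B f = Y}"

definition homcat :: "('o, 'h, 't) bicat \<Rightarrow> 'o \<Rightarrow> 'o \<Rightarrow> ('h, 't) cat" where
  "homcat B X Y = full_subcat (Cells B) (Hom1 B X Y)"

locale bicategory = cells: category "Cells B"
  for B :: "('o, 'h, 't) bicat" (structure) +
  assumes Src_Ob: "f \<in> Obj (Cells B) \<Longrightarrow> Src B f \<in> Ob0 B"
    and Trg_Ob: "f \<in> Obj (Cells B) \<Longrightarrow> Trg B f \<in> Ob0 B"
    and parallel: "\<alpha> \<in> Hom (Cells B) f g \<Longrightarrow> Src B f = Src B g \<and> Trg B f = Trg B g"
    and One_Hom1: "X \<in> Ob0 B \<Longrightarrow> One B X \<in> Hom1 B X X"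
    and HComp1_Hom1: "f \<in> Hom1 B W X \<Longrightarrow> g \<in> Hom1 B X Y \<Longrightarrow> g \<odot> f \<in> Hom1 B W Y"
    and HComp2_Hom: "\<alpha> \<in> Hom (Cells B) f f' \<Longrightarrow> \<beta> \<in> Hom (Cells B) g g' \<Longrightarrow> Trg B f = Src B g \<Longrightarrow>
      \<beta> \<star> \<alpha> \<in> Hom (Cells B) (g \<odot> f) (g' \<odot> f')"
    and HComp2_Ident: "f \<in> Hom1 B W X \<Longrightarrow> g \<in> Hom1 B X Y \<Longrightarrow>
      Ident (Cells B) g \<star> Ident (Cells B) f = Ident (Cells B) (g \<odot> f)"
    and interchange: "\<alpha> \<in> Hom (Cells B) f f' \<Longrightarrow> \<alpha>' \<in> Hom (Cells B) f' f'' \<Longrightarrow>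
      \<beta> \<in> Hom (Cells B) g g' \<Longrightarrow> \<beta>' \<in> Hom (Cells B) g' g'' \<Longrightarrow> Trg B f = Src B g \<Longrightarrow>
      (\<beta>' \<cdot>\<^bsub>Cells B\<^esub> \<beta>) \<star> (\<alpha>' \<cdot>\<^bsub>Cells B\<^esub> \<alpha>) = (\<beta>' \<star> \<alpha>') \<cdot>\<^bsub>Cells B\<^esub> (\<beta> \<star> \<alpha>)"
    and Assoc_Hom: "f \<in> Hom1 B W X \<Longrightarrow> g \<in> Hom1 B X Y \<Longrightarrow> h \<in> Hom1 B Y Z \<Longrightarrow>
      Assoc B h g f \<in> Hom (Cells B) ((h \<odot> g) \<odot> f) (h \<odot> (g \<odot> f))"
    and Assoc_iso: "f \<in> Hom1 B W X \<Longrightarrow> g \<in> Hom1 B X Y \<Longrightarrow> h \<in> Hom1 B Y Z \<Longrightarrow>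
      is_iso (Cells B) (Assoc B h g f)"
    and Assoc_natural: "\<alpha> \<in> Hom (Cells B) f f' \<Longrightarrow> \<beta> \<in> Hom (Cells B) g g' \<Longrightarrow>
      \<gamma> \<in> Hom (Cells B) h h' \<Longrightarrow> Trg B f = Src B g \<Longrightarrow> Trg B g = Src B h \<Longrightarrow>
      Assoc B h' g' f' \<cdot>\<^bsub>Cells B\<^esub> ((\<gamma> \<star> \<beta>) \<star> \<alpha>) = (\<gamma> \<star> (\<beta> \<star> \<alpha>)) \<cdot>\<^bsub>Cells B\<^esub> Assoc B h g f"
    and LUnit_Hom: "f \<in> Hom1 B X Y \<Longrightarrow> LUnit B f \<in> Hom (Cells B) (One B Y \<odot> f) f"
    and LUnit_iso: "f \<in> Hom1 B X Y \<Longrightarrow> is_iso (Cells B) (LUnit B f)"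
    and LUnit_natural: "\<alpha> \<in> Hom (Cells B) f f' \<Longrightarrow>
      LUnit B f' \<cdot>\<^bsub>Cells B\<^esub> (Ident (Cells B) (One B (Trg B f)) \<star> \<alpha>) = \<alpha> \<cdot>\<^bsub>Cells B\<^esub> LUnit B f"
    and RUnit_Hom: "f \<in> Hom1 B X Y \<Longrightarrow> RUnit B f \<in> Hom (Cells B) (f \<odot> One B X) f"
    and RUnit_iso: "f \<in> Hom1 B X Y \<Longrightarrow> is_iso (Cells B) (RUnit B f)"
    and RUnit_natural: "\<alpha> \<in> Hom (Cells B) f f' \<Longrightarrow>
      RUnit B f' \<cdot>\<^bsub>Cells B\<^esub> (\<alpha> \<star> Ident (Cells B) (One B (Src B f))) = \<alpha> \<cdot>\<^bsub>Cells B\<^esub> RUnit B f"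
    and pentagon: "f \<in> Hom1 B V W \<Longrightarrow> g \<in> Hom1 B W X \<Longrightarrow> h \<in> Hom1 B X Y \<Longrightarrow> k \<in> Hom1 B Y Z \<Longrightarrow>
      Assoc B k h (g \<odot> f) \<cdot>\<^bsub>Cells B\<^esub> Assoc B (k \<odot> h) g f =
      (Ident (Cells B) k \<star> Assoc B h g f) \<cdot>\<^bsub>Cells B\<^esub>
        (Assoc B k (h \<odot> g) f \<cdot>\<^bsub>Cells B\<^esub> (Assoc B k h g \<star> Ident (Cells B) f))"
    and triangle: "f \<in> Hom1 B X Y \<Longrightarrow> g \<in> Hom1 B Y Z \<Longrightarrow>
      (Ident (Cells B) g \<star> LUnit B f) \<cdot>\<^bsub>Cells B\<^esub> Assoc B g (One B Y) f =
      RUnit B g \<star> Ident (Cells B) f"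

text \<open>A category as a bicategory; the identity 2-morphism on \<open>f\<close> is represented by \<open>f\<close> itself.\<close>

definition loc_discrete :: "('o, 'm) cat \<Rightarrow> ('o, 'm, 'm) bicat" where
  "loc_discrete B = \<lparr>Ob0 = Obj B, Cells = discrete_cat (Arr B), Src = Dom B, Trg = Cod B,
     One = Ident B, HComp1 = Comp B, HComp2 = Comp B,
     Assoc = (\<lambda>h g f. h \<cdot>\<^bsub>B\<^esub> (g \<cdot>\<^bsub>B\<^esub> f)), LUnit = (\<lambda>f. f), RUnit = (\<lambda>f. f)\<rparr>"

lemma Hom_discrete_cat: "f \<in> Hom (discrete_cat S) x y \<longleftrightarrow> f \<in> S \<and> x = f \<and> y = f"
  by (auto simp: Hom_def discrete_cat_def)

lemma category_discrete_cat: "category (discrete_cat S)"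
  by unfold_locales (auto simp: Hom_discrete_cat, auto simp: discrete_cat_def)

lemma is_iso_discrete_cat: "f \<in> S \<Longrightarrow> is_iso (discrete_cat S) f"
  by (auto simp: is_iso_def inverse_arrows_def Hom_discrete_cat) (auto simp: discrete_cat_def)

lemma loc_discrete_simps:
  "Ob0 (loc_discrete B) = Obj B" "Cells (loc_discrete B) = discrete_cat (Arr B)"
  "Src (loc_discrete B) = Dom B" "Trg (loc_discrete B) = Cod B" "One (loc_discrete B) = Ident B"
  "HComp1 (loc_discrete B) = Comp B" "HComp2 (loc_discrete B) = Comp B"
  "Assoc (loc_discrete B) = (\<lambda>h g f. h \<cdot>\<^bsub>B\<^esub> (g \<cdot>\<^bsub>B\<^esub> f))"
  "LUnit (loc_discrete B) = (\<lambda>f. f)" "RUnit (loc_discrete B) = (\<lambda>f. f)"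
  by (simp_all add: loc_discrete_def)

lemma Hom1_loc_discrete: "Hom1 (loc_discrete B) X Y = Hom B X Y"
  by (auto simp: Hom1_def Hom_def loc_discrete_def discrete_cat_def)

lemma Hom_homcat_loc_discrete:
  "\<alpha> \<in> Hom (homcat (loc_discrete B) X Y) f g \<longleftrightarrow> \<alpha> \<in> Hom B X Y \<and> f = \<alpha> \<and> g = \<alpha>"
  by (auto simp: homcat_def full_subcat_def Hom1_loc_discrete Hom_def loc_discrete_simps
      discrete_cat_def)

lemma bicategory_loc_discrete:
  assumes "category B"
  shows "bicategory (loc_discrete B)"
proof -
  interpret B: category B by fact
  have Arr: "f \<in> Hom B X Y \<Longrightarrow> f \<in> Arr B" for f X Y by (simp add: Hom_def)
  have ArrI: "f \<in> Arr B \<Longrightarrow> f \<in> Hom B (Dom B f) (Cod B f)" for f by (simp add: Hom_def)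
  have comp_Arr: "f \<in> Arr B \<Longrightarrow> g \<in> Arr B \<Longrightarrow> Cod B f = Dom B g \<Longrightarrow>
    g \<cdot>\<^bsub>B\<^esub> f \<in> Arr B \<and> Dom B (g \<cdot>\<^bsub>B\<^esub> f) = Dom B f \<and> Cod B (g \<cdot>\<^bsub>B\<^esub> f) = Cod B g" for f g
    using B.Comp_Hom[of f "Dom B f" "Cod B f" g "Cod B g"] by (simp add: Hom_def)
  have assoc: "f \<in> Arr B \<Longrightarrow> g \<in> Arr B \<Longrightarrow> h \<in> Arr B \<Longrightarrow> Cod B f = Dom B g \<Longrightarrow>
    Cod B g = Dom B h \<Longrightarrow> (h \<cdot>\<^bsub>B\<^esub> g) \<cdot>\<^bsub>B\<^esub> f = h \<cdot>\<^bsub>B\<^esub> (g \<cdot>\<^bsub>B\<^esub> f)" for f g h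
    using B.Comp_assoc[of f "Dom B f" "Cod B f" g "Cod B g" h "Cod B h"] by (simp add: Hom_def)
  have unit: "f \<in> Arr B \<Longrightarrow> Cod B f = Y \<Longrightarrow> Ident B Y \<cdot>\<^bsub>B\<^esub> f = f"
    "f \<in> Arr B \<Longrightarrow> Dom B f = X \<Longrightarrow> f \<cdot>\<^bsub>B\<^esub> Ident B X = f" for f X Y
    using B.Ident_left[OF ArrI] B.Ident_right[OF ArrI] by auto
  have ident: "X \<in> Obj B \<Longrightarrow>
    Ident B X \<in> Arr B \<and> Dom B (Ident B X) = X \<and> Cod B (Ident B X) = X" for X
    using B.Ident_Hom[of X] by (simp add: Hom_def)
  have disc: "Ident (discrete_cat S) = (\<lambda>x. x)" "Comp (discrete_cat S) = (\<lambda>y x. x)"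
    "Obj (discrete_cat S) = S" for S :: "'b set"
    by (simp_all add: discrete_cat_def)
  show ?thesis
    apply (intro bicategory.intro bicategory_axioms.intro)
    apply (unfold loc_discrete_simps Hom1_loc_discrete Hom_discrete_cat disc)
    apply (simp_all add: category_discrete_cat is_iso_discrete_cat B.Dom_Obj B.Cod_Obj Hom_def
        comp_Arr assoc unit ident)
    done
qed

section \<open>Indexed categories\<close>

text \<open>
  The data of a pseudofunctor to the 2-category of categories, contravariant on 1-morphisms and
  covariant on 2-morphisms: \<open>Pull2 R \<alpha> Y\<close> is the component at \<open>Y\<close> of the natural transformation
  assigned to the 2-morphism \<open>\<alpha>\<close>, while \<open>\<theta>1 R A X : X \<rightarrow> (1\<^sub>A)\<^sup>* X\<close> and
  \<open>\<theta>2 R f g Z : f\<^sup>* (g\<^sup>* Z) \<rightarrow> (g \<odot> f)\<^sup>* Z\<close> are the coherence isomorphisms.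
\<close>

record ('o, 'h, 't, 'x, 'a) indexed_cat =
  Fib :: "'o \<Rightarrow> ('x, 'a) cat"
  Pull :: "'h \<Rightarrow> ('x, 'a, 'x, 'a) functr"
  Pull2 :: "'t \<Rightarrow> 'x \<Rightarrow> 'a"
  \<theta>1 :: "'o \<Rightarrow> 'x \<Rightarrow> 'a"
  \<theta>2 :: "'h \<Rightarrow> 'h \<Rightarrow> 'x \<Rightarrow> 'a"

locale indexed_category = base: bicategory B
  for B :: "('o, 'h, 't) bicat" (structure) +
  fixes R :: "('o, 'h, 't, 'x, 'a) indexed_cat"
  assumes Fib_category: "A \<in> Ob0 B \<Longrightarrow> category (Fib R A)"
    and Pull_functor: "f \<in> Hom1 B A A' \<Longrightarrow> is_functor (Fib R A') (Fib R A) (Pull R f)"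
    and Pull2_Hom: "\<alpha> \<in> Hom (homcat B A A') f g \<Longrightarrow> Y \<in> Obj (Fib R A') \<Longrightarrow>
      Pull2 R \<alpha> Y \<in> Hom (Fib R A) (ObMap (Pull R f) Y) (ObMap (Pull R g) Y)"
    and Pull2_natural: "\<alpha> \<in> Hom (homcat B A A') f g \<Longrightarrow> u \<in> Hom (Fib R A') Y Y' \<Longrightarrow>
      Pull2 R \<alpha> Y' \<cdot>\<^bsub>Fib R A\<^esub> ArMap (Pull R f) u = ArMap (Pull R g) u \<cdot>\<^bsub>Fib R A\<^esub> Pull2 R \<alpha> Y"
    and Pull2_Ident: "f \<in> Hom1 B A A' \<Longrightarrow> Y \<in> Obj (Fib R A') \<Longrightarrow>
      Pull2 R (Ident (Cells B) f) Y = Ident (Fib R A) (ObMap (Pull R f) Y)"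
    and Pull2_Comp: "\<alpha> \<in> Hom (homcat B A A') f g \<Longrightarrow> \<beta> \<in> Hom (homcat B A A') g h \<Longrightarrow>
      Y \<in> Obj (Fib R A') \<Longrightarrow>
      Pull2 R (\<beta> \<cdot>\<^bsub>Cells B\<^esub> \<alpha>) Y = Pull2 R \<beta> Y \<cdot>\<^bsub>Fib R A\<^esub> Pull2 R \<alpha> Y"
    and \<theta>1_Hom: "A \<in> Ob0 B \<Longrightarrow> X \<in> Obj (Fib R A) \<Longrightarrow>
      \<theta>1 R A X \<in> Hom (Fib R A) X (ObMap (Pull R (One B A)) X)"
    and \<theta>1_iso: "A \<in> Ob0 B \<Longrightarrow> X \<in> Obj (Fib R A) \<Longrightarrow> is_iso (Fib R A) (\<theta>1 R A X)"
    and \<theta>1_natural: "A \<in> Ob0 B \<Longrightarrow> u \<in> Hom (Fib R A) X X' \<Longrightarrow>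
      \<theta>1 R A X' \<cdot>\<^bsub>Fib R A\<^esub> u = ArMap (Pull R (One B A)) u \<cdot>\<^bsub>Fib R A\<^esub> \<theta>1 R A X"
    and \<theta>2_Hom: "f \<in> Hom1 B A A' \<Longrightarrow> g \<in> Hom1 B A' A'' \<Longrightarrow> Z \<in> Obj (Fib R A'') \<Longrightarrow>
      \<theta>2 R f g Z \<in>
        Hom (Fib R A) (ObMap (Pull R f) (ObMap (Pull R g) Z)) (ObMap (Pull R (g \<odot> f)) Z)"
    and \<theta>2_iso: "f \<in> Hom1 B A A' \<Longrightarrow> g \<in> Hom1 B A' A'' \<Longrightarrow> Z \<in> Obj (Fib R A'') \<Longrightarrow>
      is_iso (Fib R A) (\<theta>2 R f g Z)"
    and \<theta>2_natural: "f \<in> Hom1 B A A' \<Longrightarrow> g \<in> Hom1 B A' A'' \<Longrightarrow> u \<in> Hom (Fib R A'') Z Z' \<Longrightarrow>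
      \<theta>2 R f g Z' \<cdot>\<^bsub>Fib R A\<^esub> ArMap (Pull R f) (ArMap (Pull R g) u) =
      ArMap (Pull R (g \<odot> f)) u \<cdot>\<^bsub>Fib R A\<^esub> \<theta>2 R f g Z"
    and \<theta>2_natural2: "\<alpha> \<in> Hom (homcat B A A') f f' \<Longrightarrow> \<beta> \<in> Hom (homcat B A' A'') g g' \<Longrightarrow>
      Z \<in> Obj (Fib R A'') \<Longrightarrow>
      Pull2 R (\<beta> \<star> \<alpha>) Z \<cdot>\<^bsub>Fib R A\<^esub> \<theta>2 R f g Z =
      \<theta>2 R f' g' Z \<cdot>\<^bsub>Fib R A\<^esub>
        (Pull2 R \<alpha> (ObMap (Pull R g') Z) \<cdot>\<^bsub>Fib R A\<^esub> ArMap (Pull R f) (Pull2 R \<beta> Z))"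
    and \<theta>_assoc: "f \<in> Hom1 B A A' \<Longrightarrow> g \<in> Hom1 B A' A'' \<Longrightarrow> h \<in> Hom1 B A'' A''' \<Longrightarrow>
      W \<in> Obj (Fib R A''') \<Longrightarrow>
      Pull2 R (Assoc B h g f) W \<cdot>\<^bsub>Fib R A\<^esub>
        (\<theta>2 R f (h \<odot> g) W \<cdot>\<^bsub>Fib R A\<^esub> ArMap (Pull R f) (\<theta>2 R g h W)) =
      \<theta>2 R (g \<odot> f) h W \<cdot>\<^bsub>Fib R A\<^esub> \<theta>2 R f g (ObMap (Pull R h) W)"
    and \<theta>_runit: "f \<in> Hom1 B A A' \<Longrightarrow> Y \<in> Obj (Fib R A') \<Longrightarrow>
      Pull2 R (RUnit B f) Y \<cdot>\<^bsub>Fib R A\<^esub>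
        (\<theta>2 R (One B A) f Y \<cdot>\<^bsub>Fib R A\<^esub> \<theta>1 R A (ObMap (Pull R f) Y)) =
      Ident (Fib R A) (ObMap (Pull R f) Y)"
    and \<theta>_lunit: "f \<in> Hom1 B A A' \<Longrightarrow> Y \<in> Obj (Fib R A') \<Longrightarrow>
      Pull2 R (LUnit B f) Y \<cdot>\<^bsub>Fib R A\<^esub>
        (\<theta>2 R f (One B A') Y \<cdot>\<^bsub>Fib R A\<^esub> ArMap (Pull R f) (\<theta>1 R A' Y)) =
      Ident (Fib R A) (ObMap (Pull R f) Y)"

definition trivial_indexed :: "('o, 'h, 't, unit, unit) indexed_cat" where
  "trivial_indexed = \<lparr>Fib = (\<lambda>_. discrete_cat UNIV), Pull = (\<lambda>_. \<lparr>ObMap = (\<lambda>u. u), ArMap = (\<lambda>u. u)\<rparr>),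
     Pull2 = (\<lambda>_ u. u), \<theta>1 = (\<lambda>_ u. u), \<theta>2 = (\<lambda>_ _ u. u)\<rparr>"

lemma indexed_category_trivial:
  assumes "bicategory B"
  shows "indexed_category B trivial_indexed"
proof -
  interpret bicategory B by fact
  have triv: "Fib trivial_indexed A = discrete_cat UNIV" for A :: 'a
    by (simp add: trivial_indexed_def)
  have Hom: "Hom (discrete_cat UNIV) u v = (UNIV :: unit set)" for u v
    by (auto simp: Hom_discrete_cat)
  have iso: "is_iso (discrete_cat UNIV) (u :: unit)" for u
    by (simp add: is_iso_discrete_cat)
  have Obj: "Obj (discrete_cat (UNIV :: unit set)) = UNIV"
    by (simp add: discrete_cat_def)
  show ?thesis
    apply (intro indexed_category.intro indexed_category_axioms.intro is_functor.intro
        is_functor_axioms.intro bicategory_axioms)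
    apply (unfold triv Hom Obj)
    apply (simp_all add: category_discrete_cat iso)
    done
qed

section \<open>Functor lenses\<close>

text \<open>
  The pointwise opposite is taken over a category only, where the sole 2-morphisms are identities;
  in general it would reverse the direction of \<open>Pull2\<close>.
\<close>

definition pointwise_op ::
  "('o, 'm) cat \<Rightarrow> ('o, 'm, 'm, 'x, 'a) indexed_cat \<Rightarrow> ('o, 'm, 'm, 'x, 'a) indexed_cat" where
  "pointwise_op B R = \<lparr>Fib = (\<lambda>A. op_cat (Fib R A)), Pull = Pull R, Pull2 = Pull2 R,
     \<theta>1 = (\<lambda>A X. inv_arr (Fib R A) (\<theta>1 R A X)),
     \<theta>2 = (\<lambda>f g Z. inv_arr (Fib R (Dom B f)) (\<theta>2 R f g Z))\<rparr>"

text \<open>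
  Arrows \<open>(A, X) \<rightarrow> (B, Y)\<close> are pairs of \<open>f : A \<rightarrow> B\<close> and \<open>u : X \<rightarrow> f\<^sup>* Y\<close>, tagged with their
  endpoints.
\<close>

definition grothendieck ::
  "('o, 'm) cat \<Rightarrow> ('o, 'm, 'm, 'x, 'a) indexed_cat \<Rightarrow>
   ('o \<times> 'x, ('o \<times> 'x) \<times> ('m \<times> 'a) \<times> ('o \<times> 'x)) cat" where
  "grothendieck B R = \<lparr>
     Obj = (SIGMA A:Obj B. Obj (Fib R A)),
     Arr = {((A, X), (f, u), (A', Y)) | A X f u A' Y.
       A \<in> Obj B \<and> X \<in> Obj (Fib R A) \<and> A' \<in> Obj B \<and> Y \<in> Obj (Fib R A') \<and>
       f \<in> Hom B A A' \<and> u \<in> Hom (Fib R A) X (ObMap (Pull R f) Y)},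
     Dom = (\<lambda>(P, _, _). P),
     Cod = (\<lambda>(_, _, Q). Q),
     Ident = (\<lambda>(A, X). ((A, X), (Ident B A, \<theta>1 R A X), (A, X))),
     Comp = (\<lambda>(_, (g, v), (A'', Z)) ((A, X), (f, u), _).
       ((A, X),
        (g \<cdot>\<^bsub>B\<^esub> f, \<theta>2 R f g Z \<cdot>\<^bsub>Fib R A\<^esub> (ArMap (Pull R f) v \<cdot>\<^bsub>Fib R A\<^esub> u)),
        (A'', Z)))\<rparr>"

definition Lens ::
  "('o, 'm) cat \<Rightarrow> ('o, 'm, 'm, 'x, 'a) indexed_cat \<Rightarrow>
   ('o \<times> 'x, ('o \<times> 'x) \<times> ('m \<times> 'a) \<times> ('o \<times> 'x)) cat" where
  "Lens B R = grothendieck B (pointwise_op B R)"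

section \<open>Coends of set-valued functors\<close>

text \<open>
  A functor from \<open>C\<^sup>o\<^sup>p \<times> C\<close> to sets is given by its values \<open>P c d\<close> (contravariant in \<open>c\<close>) and its
  action \<open>act \<alpha> \<beta> : P (Cod \<alpha>) (Dom \<beta>) \<rightarrow> P (Dom \<alpha>) (Cod \<beta>)\<close> on arrows.
\<close>

definition coend_gen ::
  "('o, 'm) cat \<Rightarrow> ('o \<Rightarrow> 'o \<Rightarrow> 'e set) \<Rightarrow> ('m \<Rightarrow> 'm \<Rightarrow> 'e \<Rightarrow> 'e) \<Rightarrow> (('o \<times> 'e) \<times> ('o \<times> 'e)) set" where
  "coend_gen C P act =
     {((c, act \<alpha> (Ident C c) x), (d, act (Ident C d) \<alpha> x)) | c d \<alpha> x. \<alpha> \<in> Hom C c d \<and> x \<in> P d c}"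

definition coend_rel ::
  "('o, 'm) cat \<Rightarrow> ('o \<Rightarrow> 'o \<Rightarrow> 'e set) \<Rightarrow> ('m \<Rightarrow> 'm \<Rightarrow> 'e \<Rightarrow> 'e) \<Rightarrow> (('o \<times> 'e) \<times> ('o \<times> 'e)) set" where
  "coend_rel C P act = (coend_gen C P act \<union> (coend_gen C P act)\<inverse>)\<^sup>*"

definition coend ::
  "('o, 'm) cat \<Rightarrow> ('o \<Rightarrow> 'o \<Rightarrow> 'e set) \<Rightarrow> ('m \<Rightarrow> 'm \<Rightarrow> 'e \<Rightarrow> 'e) \<Rightarrow> ('o \<times> 'e) set set" where
  "coend C P act = (SIGMA c:Obj C. P c c) // coend_rel C P act"

definition coend_inj ::
  "('o, 'm) cat \<Rightarrow> ('o \<Rightarrow> 'o \<Rightarrow> 'e set) \<Rightarrow> ('m \<Rightarrow> 'm \<Rightarrow> 'e \<Rightarrow> 'e) \<Rightarrow> 'o \<Rightarrow> 'e \<Rightarrow> ('o \<times> 'e) set" where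
  "coend_inj C P act c x = coend_rel C P act `` {(c, x)}"

lemma equiv_coend_rel: "equiv UNIV (coend_rel C P act)"
proof (rule equivI)
  show "sym (coend_rel C P act)"
    unfolding coend_rel_def by (intro sym_rtrancl sym_Un_converse)
qed (auto simp: coend_rel_def refl_rtrancl trans_rtrancl)

lemma coend_inj_in_coend: "c \<in> Obj C \<Longrightarrow> x \<in> P c c \<Longrightarrow> coend_inj C P act c x \<in> coend C P act"
  unfolding coend_def coend_inj_def by (intro quotientI) simp

lemma coend_inj_cowedge:
  assumes "\<alpha> \<in> Hom C c d" "x \<in> P d c"
  shows "coend_inj C P act c (act \<alpha> (Ident C c) x) = coend_inj C P act d (act (Ident C d) \<alpha> x)"
  unfolding coend_inj_def
proof (rule equiv_class_eq[OF equiv_coend_rel])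
  show "((c, act \<alpha> (Ident C c) x), (d, act (Ident C d) \<alpha> x)) \<in> coend_rel C P act"
    unfolding coend_rel_def coend_gen_def using assms by (intro r_into_rtrancl) blast
qed

theorem coend_universal:
  assumes w: "\<And>c. c \<in> Obj C \<Longrightarrow> w c \<in> P c c \<rightarrow> T"
    and cowedge: "\<And>c d \<alpha> x. \<alpha> \<in> Hom C c d \<Longrightarrow> x \<in> P d c \<Longrightarrow>
      w c (act \<alpha> (Ident C c) x) = w d (act (Ident C d) \<alpha> x)"
  shows "\<exists>!h. h \<in> coend C P act \<rightarrow>\<^sub>E T \<and>
    (\<forall>c \<in> Obj C. \<forall>x \<in> P c c. h (coend_inj C P act c x) = w c x)"
proof -
  let ?E = "coend_rel C P act"
  have step: "(p, q) \<in> ?E \<Longrightarrow> case_prod w p = case_prod w q" for p q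
    unfolding coend_rel_def
  proof (induction rule: rtrancl_induct)
    case (step y z)
    then show ?case using cowedge unfolding coend_gen_def by auto
  qed simp
  have cls: "\<exists>c \<in> Obj C. \<exists>x \<in> P c c. K = coend_inj C P act c x" if "K \<in> coend C P act" for K
    using that unfolding coend_def coend_inj_def by (auto elim!: quotientE)
  define h where "h = restrict (\<lambda>K. case_prod w (SOME p. p \<in> K)) (coend C P act)"
  have h: "h (coend_inj C P act c x) = w c x" if "c \<in> Obj C" "x \<in> P c c" for c x
  proof -
    have "(c, x) \<in> coend_inj C P act c x"
      unfolding coend_inj_def coend_rel_def by simp
    then have "(SOME p. p \<in> coend_inj C P act c x) \<in> coend_inj C P act c x"
      by (rule someI)
    then have "((c, x), SOME p. p \<in> coend_inj C P act c x) \<in> ?E"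
      by (simp add: coend_inj_def)
    from step[OF this] show ?thesis
      using coend_inj_in_coend[where P = P and act = act, OF that] by (simp add: h_def)
  qed
  show ?thesis
  proof (rule ex1I[of _ h], intro conjI ballI)
    show "h \<in> coend C P act \<rightarrow>\<^sub>E T"
    proof (rule PiE_I)
      fix K assume "K \<in> coend C P act"
      with cls obtain c x where "c \<in> Obj C" "x \<in> P c c" "K = coend_inj C P act c x" by blast
      then show "h K \<in> T" using h w by auto
    qed (simp add: h_def)
  next
    fix k
    assume k: "k \<in> coend C P act \<rightarrow>\<^sub>E T \<and>
      (\<forall>c \<in> Obj C. \<forall>x \<in> P c c. k (coend_inj C P act c x) = w c x)"
    show "k = h"
    proof
      fix K show "k K = h K"
      proof (cases "K \<in> coend C P act")
        case True
        with cls obtain c x where "c \<in> Obj C" "x \<in> P c c" "K = coend_inj C P act c x" by blast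
        then show ?thesis using h[of c x] k by simp
      next
        case False
        then show ?thesis using k PiE_arb[of k _ _ K] unfolding h_def by (metis restrict_apply)
      qed
    qed
  qed (rule h)
qed

section \<open>Dependent optics\<close>

definition optic_val ::
  "('o, 'h, 't, 'x, 'a) indexed_cat \<Rightarrow> ('o, 'h, 't, 'y, 'b) indexed_cat \<Rightarrow>
   'o \<times> 'x \<times> 'y \<Rightarrow> 'o \<times> 'x \<times> 'y \<Rightarrow> 'h \<Rightarrow> 'h \<Rightarrow> ('a \<times> 'b) set" where
  "optic_val L R = (\<lambda>(A, X, X') (B, Y, Y') f g.
     Hom (Fib L A) X (ObMap (Pull L g) Y) \<times> Hom (Fib R A) (ObMap (Pull R f) Y') X')"

definition optic_act ::
  "('o, 'h, 't, 'x, 'a) indexed_cat \<Rightarrow> ('o, 'h, 't, 'y, 'b) indexed_cat \<Rightarrow>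
   'o \<times> 'x \<times> 'y \<Rightarrow> 'o \<times> 'x \<times> 'y \<Rightarrow> 't \<Rightarrow> 't \<Rightarrow> 'a \<times> 'b \<Rightarrow> 'a \<times> 'b" where
  "optic_act L R = (\<lambda>(A, X, X') (B, Y, Y') \<alpha> \<beta> (l, r).
     (Pull2 L \<beta> Y \<cdot>\<^bsub>Fib L A\<^esub> l, r \<cdot>\<^bsub>Fib R A\<^esub> Pull2 R \<alpha> Y'))"

definition optic_hom ::
  "('o, 'h, 't) bicat \<Rightarrow> ('o, 'h, 't, 'x, 'a) indexed_cat \<Rightarrow> ('o, 'h, 't, 'y, 'b) indexed_cat \<Rightarrow>
   'o \<times> 'x \<times> 'y \<Rightarrow> 'o \<times> 'x \<times> 'y \<Rightarrow> ('h \<times> 'a \<times> 'b) set set" where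
  "optic_hom B L R P Q = coend (homcat B (fst P) (fst Q)) (optic_val L R P Q) (optic_act L R P Q)"

text \<open>The class of \<open>(l, r)\<close> with representative \<open>f\<close>.\<close>

definition optic_class ::
  "('o, 'h, 't) bicat \<Rightarrow> ('o, 'h, 't, 'x, 'a) indexed_cat \<Rightarrow> ('o, 'h, 't, 'y, 'b) indexed_cat \<Rightarrow>
   'o \<times> 'x \<times> 'y \<Rightarrow> 'o \<times> 'x \<times> 'y \<Rightarrow> 'h \<Rightarrow> 'a \<Rightarrow> 'b \<Rightarrow> ('h \<times> 'a \<times> 'b) set" where
  "optic_class B L R P Q f l r =
     coend_inj (homcat B (fst P) (fst Q)) (optic_val L R P Q) (optic_act L R P Q) f (l, r)"

text \<open>
  Arrows are tagged with their endpoints. Composition is lifted to classes as a union over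
  representatives, as usual for operations on quotients.
\<close>

definition Optic ::
  "('o, 'h, 't) bicat \<Rightarrow> ('o, 'h, 't, 'x, 'a) indexed_cat \<Rightarrow> ('o, 'h, 't, 'y, 'b) indexed_cat \<Rightarrow>
   ('o \<times> 'x \<times> 'y, ('o \<times> 'x \<times> 'y) \<times> ('h \<times> 'a \<times> 'b) set \<times> ('o \<times> 'x \<times> 'y)) cat" where
  "Optic B L R =
     (let Ob = (SIGMA A:Ob0 B. Obj (Fib L A) \<times> Obj (Fib R A)) in
      \<lparr>Obj = Ob,
       Arr = {(P, c, Q) | P c Q. P \<in> Ob \<and> Q \<in> Ob \<and> c \<in> optic_hom B L R P Q},
       Dom = (\<lambda>(P, _, _). P),
       Cod = (\<lambda>(_, _, Q). Q),
       Ident = (\<lambda>(A, X, X').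
         ((A, X, X'),
          optic_class B L R (A, X, X') (A, X, X') (One B A)
            (\<theta>1 L A X) (inv_arr (Fib R A) (\<theta>1 R A X')),
          (A, X, X'))),
       Comp = (\<lambda>(_, c2, (A'', Z, Z')) ((A, X, X'), c1, _).
         ((A, X, X'),
          (\<Union>(f, l1, r1) \<in> c1. \<Union>(g, l2, r2) \<in> c2.
             optic_class B L R (A, X, X') (A'', Z, Z') (g \<odot>\<^bsub>B\<^esub> f)
               (\<theta>2 L f g Z \<cdot>\<^bsub>Fib L A\<^esub> (ArMap (Pull L f) l2 \<cdot>\<^bsub>Fib L A\<^esub> l1))
               (r1 \<cdot>\<^bsub>Fib R A\<^esub>
                 (ArMap (Pull R f) r2 \<cdot>\<^bsub>Fib R A\<^esub> inv_arr (Fib R A) (\<theta>2 R f g Z')))),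
          (A'', Z, Z')))\<rparr>)"

end

(* Over a locally discrete base the only 2-morphisms are identities, so the relation generating
   the coend is contained in equality and every class is a singleton {(f, (), r)}. Hence dependent
   optics with trivial L are pairs (f, r), composed as in Lens R. Only Lens R is shown directly to
   be a category; the structure is then transported along the bijection. *)
theory Submission
  imports Defs
begin

text \<open>\<open>Lens B R\<close> carries the calculation because its arrows are explicit pairs,
  without a quotient. The work lies in coherence: an indexed category states its axioms for
  \<open>\<theta>1\<close> and \<open>\<theta>2\<close>, while lenses and the right halves of optics
  both compose with the inverses of these maps. Every axiom has to be turned around, naturality
  squares by \<open>inverse_square\<close>, associativity and unit laws by uniqueness of inverses.
  Composition in \<open>B\<close> is strictly associative and unital, but \<open>\<theta>1\<close>
  and \<open>\<theta>2\<close> need not be identities, so \<open>R\<close> remains a genuine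
  pseudofunctor. What does become strict are the associator and unitors of the base: they are
  identity 2-morphisms, and \<open>Pull2\<close> sends them to identities.

  The two composites do not have the same shape by definition: the opposite fibres bracket to the
  left, the optic formula to the right, and one use of associativity in the fibre makes them
  agree.\<close>

section \<open>Isomorphisms in a category\<close>

lemma HomI: "f \<in> Arr C \<Longrightarrow> f \<in> Hom C (Dom C f) (Cod C f)"
  by (simp add: Hom_def)

lemma Hom_op_cat: "Hom (op_cat C) X Y = Hom C Y X"
  by (auto simp: Hom_def op_cat_def)

context category
begin

lemma Hom_Obj: "f \<in> Hom C X Y \<Longrightarrow> X \<in> Obj C \<and> Y \<in> Obj C"
  using Dom_Obj Cod_Obj by (auto simp: Hom_def)

lemma inverse_arrows_iff:
  "f \<in> Hom C X Y \<Longrightarrow> inverse_arrows C f g \<longleftrightarrow>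
    g \<in> Hom C Y X \<and> g \<cdot> f = Ident C X \<and> f \<cdot> g = Ident C Y"
  by (auto simp: inverse_arrows_def Hom_def)

text \<open>Besides justifying the \<open>THE\<close> in \<open>inv_arr\<close>, this is how the
  coherence equations for inverses are proved later: both sides invert the same arrow.\<close>

lemma inverse_arrows_unique:
  assumes "inverse_arrows C f g" "inverse_arrows C f h"
  shows "g = h"
proof -
  have f: "f \<in> Hom C (Dom C f) (Cod C f)"
    using assms by (simp add: inverse_arrows_def Hom_def)
  note g = assms(1)[unfolded inverse_arrows_iff[OF f]]
  note h = assms(2)[unfolded inverse_arrows_iff[OF f]]
  have "g = (h \<cdot> f) \<cdot> g"
    using g h Ident_left by metis
  also have "\<dots> = h \<cdot> (f \<cdot> g)"
    using Comp_assoc[OF _ f] g h by blast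
  also have "\<dots> = h"
    using g h Ident_right by metis
  finally show ?thesis .
qed

lemma inv_arr_eqI: "inverse_arrows C f g \<Longrightarrow> inv_arr C f = g"
  unfolding inv_arr_def using inverse_arrows_unique by blast

lemma inverse_arrows_inv_arr: "is_iso C f \<Longrightarrow> inverse_arrows C f (inv_arr C f)"
  unfolding is_iso_def using inv_arr_eqI by blast

lemma inverse_arrows_Ident: "X \<in> Obj C \<Longrightarrow> inverse_arrows C (Ident C X) (Ident C X)"
  using Ident_Hom Ident_left by (subst inverse_arrows_iff) blast+

lemma inverse_arrows_Comp:
  assumes f: "f \<in> Hom C X Y" and g: "g \<in> Hom C Y Z"
    and "inverse_arrows C f f'" "inverse_arrows C g g'"
  shows "inverse_arrows C (g \<cdot> f) (f' \<cdot> g')"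
proof -
  have f': "f' \<in> Hom C Y X" "f' \<cdot> f = Ident C X" "f \<cdot> f' = Ident C Y"
    and g': "g' \<in> Hom C Z Y" "g' \<cdot> g = Ident C Y" "g \<cdot> g' = Ident C Z"
    using assms by (simp_all add: inverse_arrows_iff)
  have "(f' \<cdot> g') \<cdot> (g \<cdot> f) = f' \<cdot> ((g' \<cdot> g) \<cdot> f)"
    using Comp_assoc[OF Comp_Hom[OF f g] g'(1) f'(1)] Comp_assoc[OF f g g'(1)] by simp
  then have 1: "(f' \<cdot> g') \<cdot> (g \<cdot> f) = Ident C X"
    using f' g' Ident_left[OF f] by simp
  have "(g \<cdot> f) \<cdot> (f' \<cdot> g') = g \<cdot> ((f \<cdot> f') \<cdot> g')"
    using Comp_assoc[OF Comp_Hom[OF g'(1) f'(1)] f g] Comp_assoc[OF g'(1) f'(1) f] by simp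
  then have 2: "(g \<cdot> f) \<cdot> (f' \<cdot> g') = Ident C Z"
    using f' g' Ident_left[OF g'(1)] by simp
  show ?thesis
    using 1 2 Comp_Hom[OF g'(1) f'(1)] by (simp add: inverse_arrows_iff[OF Comp_Hom[OF f g]])
qed

text \<open>Insert \<open>b' \<cdot> b\<close> on the left of \<open>u \<cdot> a'\<close>, apply the
  square, and cancel \<open>a \<cdot> a'\<close>. Used to turn naturality of a coherence map into
  naturality of its inverse.\<close>

lemma inverse_square:
  assumes a: "a \<in> Hom C X X'" and b: "b \<in> Hom C Y Y'"
    and u: "u \<in> Hom C X Y" and v: "v \<in> Hom C X' Y'"
    and inv: "inverse_arrows C a a'" "inverse_arrows C b b'"
    and square: "b \<cdot> u = v \<cdot> a"
  shows "u \<cdot> a' = b' \<cdot> v"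
proof -
  have a': "a' \<in> Hom C X' X" "a \<cdot> a' = Ident C X'" and b': "b' \<in> Hom C Y' Y" "b' \<cdot> b = Ident C Y"
    using inv by (simp_all add: inverse_arrows_iff[OF a] inverse_arrows_iff[OF b])
  have ua: "u \<cdot> a' \<in> Hom C X' Y"
    using Comp_Hom[OF a'(1) u] .
  have "u \<cdot> a' = b' \<cdot> (b \<cdot> (u \<cdot> a'))"
    using Ident_left[OF ua] Comp_assoc[OF ua b b'(1)] b'(2) by simp
  also have "b \<cdot> (u \<cdot> a') = v \<cdot> (a \<cdot> a')"
    using Comp_assoc[OF a'(1) u b] Comp_assoc[OF a'(1) a v] square by simp
  also have "\<dots> = v"
    using a'(2) Ident_right[OF v] by simp
  finally show ?thesis .
qed

end

lemma (in is_functor) inverse_arrows_ArMap: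
  assumes "inverse_arrows C f g"
  shows "inverse_arrows D (ArMap F f) (ArMap F g)"
proof -
  have f: "f \<in> Hom C (Dom C f) (Cod C f)"
    using assms by (simp add: inverse_arrows_def Hom_def)
  note g = assms[unfolded dom.inverse_arrows_iff[OF f]]
  show ?thesis
    unfolding cod.inverse_arrows_iff[OF ArMap_Hom[OF f]]
    using g f dom.Hom_Obj[OF f] ArMap_Hom ArMap_Comp ArMap_Ident by metis
qed

section \<open>Transport of a category structure\<close>

text \<open>The two sides of each law are arrows of \<open>C\<close> whose images agree by the same
  law in \<open>D\<close>, and injectivity on arrows reflects the equation. That \<open>C\<close> is
  a category is part of the conclusion, since \<open>is_functor\<close> includes it.\<close>

lemma category_transport:
  assumes "category D"
    and inj: "inj_on (ArMap F) (Arr C)"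
    and ob: "inj_on (ObMap F) (Obj C)"
    and Obj: "\<And>X. X \<in> Obj C \<Longrightarrow> ObMap F X \<in> Obj D"
    and Arr: "\<And>f. f \<in> Arr C \<Longrightarrow> ArMap F f \<in> Arr D \<and> Dom C f \<in> Obj C \<and> Cod C f \<in> Obj C \<and>
      Dom D (ArMap F f) = ObMap F (Dom C f) \<and> Cod D (ArMap F f) = ObMap F (Cod C f)"
    and Ident: "\<And>X. X \<in> Obj C \<Longrightarrow>
      Ident C X \<in> Hom C X X \<and> ArMap F (Ident C X) = Ident D (ObMap F X)"
    and Comp: "\<And>f g X Y Z. f \<in> Hom C X Y \<Longrightarrow> g \<in> Hom C Y Z \<Longrightarrow>
      g \<cdot>\<^bsub>C\<^esub> f \<in> Hom C X Z \<and> ArMap F (g \<cdot>\<^bsub>C\<^esub> f) = ArMap F g \<cdot>\<^bsub>D\<^esub> ArMap F f"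
  shows "is_functor C D F"
proof -
  interpret D: category D by fact
  have Hom: "ArMap F f \<in> Hom D (ObMap F X) (ObMap F Y)" "X \<in> Obj C" "Y \<in> Obj C" "f \<in> Arr C"
    if "f \<in> Hom C X Y" for f X Y
    using Arr[of f] that by (auto simp: Hom_def)
  have eqI: "f = g" if "f \<in> Hom C X Y" "g \<in> Hom C X' Y'" "ArMap F f = ArMap F g" for f g X Y X' Y'
    using inj_onD[OF inj that(3)] Hom(4)[OF that(1)] Hom(4)[OF that(2)] by blast
  interpret C: category C
  proof
    show "Dom C f \<in> Obj C" "Cod C f \<in> Obj C" if "f \<in> Arr C" for f
      using Arr[OF that] by auto
    show "Ident C X \<in> Hom C X X" if "X \<in> Obj C" for X
      using Ident[OF that] by blast
    show "g \<cdot>\<^bsub>C\<^esub> f \<in> Hom C X Z" if "f \<in> Hom C X Y" "g \<in> Hom C Y Z" for f g X Y Z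
      using Comp[OF that] by blast
    show "Ident C Y \<cdot>\<^bsub>C\<^esub> f = f" if f: "f \<in> Hom C X Y" for f X Y
    proof (rule eqI)
      show "Ident C Y \<cdot>\<^bsub>C\<^esub> f \<in> Hom C X Y"
        using Comp[OF f] Ident[OF Hom(3)[OF f]] by blast
      show "ArMap F (Ident C Y \<cdot>\<^bsub>C\<^esub> f) = ArMap F f"
        using Comp[OF f] Ident[OF Hom(3)[OF f]] D.Ident_left[OF Hom(1)[OF f]] by metis
    qed fact
    show "f \<cdot>\<^bsub>C\<^esub> Ident C X = f" if f: "f \<in> Hom C X Y" for f X Y
    proof (rule eqI)
      show "f \<cdot>\<^bsub>C\<^esub> Ident C X \<in> Hom C X Y"
        using Comp[OF _ f] Ident[OF Hom(2)[OF f]] by blast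
      show "ArMap F (f \<cdot>\<^bsub>C\<^esub> Ident C X) = ArMap F f"
        using Comp[OF _ f] Ident[OF Hom(2)[OF f]] D.Ident_right[OF Hom(1)[OF f]] by metis
    qed fact
    show "(h \<cdot>\<^bsub>C\<^esub> g) \<cdot>\<^bsub>C\<^esub> f = h \<cdot>\<^bsub>C\<^esub> (g \<cdot>\<^bsub>C\<^esub> f)"
      if f: "f \<in> Hom C W X" and g: "g \<in> Hom C X Y" and h: "h \<in> Hom C Y Z" for f g h W X Y Z
    proof (rule eqI)
      show "(h \<cdot>\<^bsub>C\<^esub> g) \<cdot>\<^bsub>C\<^esub> f \<in> Hom C W Z"
        using Comp[OF f] Comp[OF g h] by blast
      show "h \<cdot>\<^bsub>C\<^esub> (g \<cdot>\<^bsub>C\<^esub> f) \<in> Hom C W Z"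
        using Comp[OF _ h] Comp[OF f g] by blast
      show "ArMap F ((h \<cdot>\<^bsub>C\<^esub> g) \<cdot>\<^bsub>C\<^esub> f) = ArMap F (h \<cdot>\<^bsub>C\<^esub> (g \<cdot>\<^bsub>C\<^esub> f))"
        using Comp[OF f] Comp[OF g h] Comp[OF _ h] Comp[OF f g]
          D.Comp_assoc[OF Hom(1)[OF f] Hom(1)[OF g] Hom(1)[OF h]] by metis
    qed
  qed
  show ?thesis
    using Obj Hom(1) Ident Comp by unfold_locales blast+
qed

text \<open>The inverse maps inherit each functor law: apply \<open>F\<close>, under which both
  sides become equal in \<open>D\<close>, then cancel it by applying \<open>G\<close>.\<close>

lemma (in is_functor) is_cat_iso_if_bij:
  assumes ob: "bij_betw (ObMap F) (Obj C) (Obj D)" and ar: "bij_betw (ArMap F) (Arr C) (Arr D)"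
  shows "is_cat_iso C D F"
proof -
  define G where "G = \<lparr>ObMap = inv_into (Obj C) (ObMap F), ArMap = inv_into (Arr C) (ArMap F)\<rparr>"
  have GO: "ObMap G (ObMap F X) = X" if "X \<in> Obj C" for X
    using bij_betw_inv_into_left[OF ob that] by (simp add: G_def)
  have GA: "ArMap G (ArMap F f) = f" if "f \<in> Arr C" for f
    using bij_betw_inv_into_left[OF ar that] by (simp add: G_def)
  have FO: "ObMap F (ObMap G X) = X" "ObMap G X \<in> Obj C" if "X \<in> Obj D" for X
    using bij_betw_inv_into_right[OF ob that] bij_betwE[OF bij_betw_inv_into[OF ob]] that
    by (auto simp: G_def)
  have FA: "ArMap F (ArMap G f) = f" "ArMap G f \<in> Arr C" if "f \<in> Arr D" for f
    using bij_betw_inv_into_right[OF ar that] bij_betwE[OF bij_betw_inv_into[OF ar]] that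
    by (auto simp: G_def)
  have Hom: "ArMap G f \<in> Hom C (ObMap G X) (ObMap G Y)" if f: "f \<in> Hom D X Y" for f X Y
  proof -
    have "f \<in> Arr D" using f by (simp add: Hom_def)
    note g = FA[OF this]
    \<comment> \<open>The endpoints of \<open>ArMap G f\<close> are found by mapping it back to
      \<open>f\<close>, whose endpoints are known.\<close>
    have "f \<in> Hom D (ObMap F (Dom C (ArMap G f))) (ObMap F (Cod C (ArMap G f)))"
      using ArMap_Hom[OF HomI[OF g(2)]] g(1) by simp
    then have "X = ObMap F (Dom C (ArMap G f))" "Y = ObMap F (Cod C (ArMap G f))"
      using f by (auto simp: Hom_def)
    then show ?thesis
      using g(2) GO dom.Dom_Obj dom.Cod_Obj by (simp add: Hom_def)
  qed
  have "is_functor D C G"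
  proof unfold_locales
    show "ArMap G (Ident D X) = Ident C (ObMap G X)" if X: "X \<in> Obj D" for X
      using ArMap_Ident[OF FO(2)[OF X]] FO(1)[OF X] GA[of "Ident C (ObMap G X)"]
        dom.Ident_Hom[OF FO(2)[OF X]] by (simp add: Hom_def)
    show "ArMap G (g \<cdot>\<^bsub>D\<^esub> f) = ArMap G g \<cdot>\<^bsub>C\<^esub> ArMap G f"
      if f: "f \<in> Hom D X Y" and g: "g \<in> Hom D Y Z" for f g X Y Z
    proof -
      have "ArMap F (ArMap G g \<cdot>\<^bsub>C\<^esub> ArMap G f) = g \<cdot>\<^bsub>D\<^esub> f"
        using ArMap_Comp[OF Hom[OF f] Hom[OF g]] FA(1) f g by (simp add: Hom_def)
      moreover have "ArMap G g \<cdot>\<^bsub>C\<^esub> ArMap G f \<in> Arr C"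
        using dom.Comp_Hom[OF Hom[OF f] Hom[OF g]] by (simp add: Hom_def)
      ultimately show ?thesis using GA by metis
    qed
  qed (use FO Hom in auto)
  then show ?thesis
    unfolding is_cat_iso_def using is_functor_axioms GO GA FO FA by blast
qed

section \<open>The category of functor lenses\<close>

locale indexed_category_over_category = base_cat: category B + ind: indexed_category "loc_discrete B" R
  for B :: "('o, 'm) cat" and R :: "('o, 'm, 'm, 'y, 'b) indexed_cat"
begin

abbreviation pull_ob (infixr "\<triangleright>" 75) where "f \<triangleright> Y \<equiv> ObMap (Pull R f) Y"
abbreviation pull_ar (infixr "\<bullet>" 75) where "f \<bullet> u \<equiv> ArMap (Pull R f) u"

text \<open>The inverse coherence maps occur on both sides of the comparison: they are the coherence
  maps of \<open>pointwise_op B R\<close>, and they enter the identities and composites of optics.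
  The fibre for \<open>\<phi>2\<close> is read off from \<open>f\<close>.\<close>

definition \<phi>1 where "\<phi>1 A X = inv_arr (Fib R A) (\<theta>1 R A X)"
definition \<phi>2 where "\<phi>2 f g Z = inv_arr (Fib R (Dom B f)) (\<theta>2 R f g Z)"

lemmas Fib_category = ind.Fib_category[unfolded loc_discrete_simps]
lemmas Pull_functor = ind.Pull_functor[unfolded Hom1_loc_discrete]
lemmas \<theta>1_Hom = ind.\<theta>1_Hom[unfolded loc_discrete_simps]
lemmas \<theta>2_Hom = ind.\<theta>2_Hom[unfolded loc_discrete_simps Hom1_loc_discrete]

lemma Hom_base: "f \<in> Hom B A A' \<Longrightarrow> A \<in> Obj B \<and> A' \<in> Obj B \<and> Dom B f = A"
  using base_cat.Hom_Obj by (auto simp: Hom_def)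

lemma pull_ob_Obj: "f \<in> Hom B A A' \<Longrightarrow> Y \<in> Obj (Fib R A') \<Longrightarrow> f \<triangleright> Y \<in> Obj (Fib R A)"
  using Pull_functor by (rule is_functor.ObMap_Obj)

lemma pull_ar_Hom:
  "f \<in> Hom B A A' \<Longrightarrow> u \<in> Hom (Fib R A') Y Y' \<Longrightarrow> f \<bullet> u \<in> Hom (Fib R A) (f \<triangleright> Y) (f \<triangleright> Y')"
  using Pull_functor by (rule is_functor.ArMap_Hom)

lemma pull_ar_Comp:
  "f \<in> Hom B A A' \<Longrightarrow> u \<in> Hom (Fib R A') X Y \<Longrightarrow> v \<in> Hom (Fib R A') Y Z \<Longrightarrow>
    f \<bullet> (v \<cdot>\<^bsub>Fib R A'\<^esub> u) = (f \<bullet> v) \<cdot>\<^bsub>Fib R A\<^esub> (f \<bullet> u)"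
  using Pull_functor by (rule is_functor.ArMap_Comp)

text \<open>In \<open>loc_discrete B\<close> the 1-morphism \<open>f\<close> is its own identity
  2-morphism, so \<open>Pull2_Ident\<close> applies. This removes the associator and the unitors
  from the axioms for \<open>\<theta>1\<close> and \<open>\<theta>2\<close>.\<close>

lemma Pull2_loc_discrete:
  "f \<in> Hom B A A' \<Longrightarrow> Y \<in> Obj (Fib R A') \<Longrightarrow> Pull2 R f Y = Ident (Fib R A) (f \<triangleright> Y)"
  using ind.Pull2_Ident[of f A A' Y] by (simp add: loc_discrete_simps Hom1_loc_discrete discrete_cat_def)

section \<open>Coherence and naturality of the inverse maps\<close>

lemma inverse_\<phi>1: "A \<in> Obj B \<Longrightarrow> X \<in> Obj (Fib R A) \<Longrightarrow> inverse_arrows (Fib R A) (\<theta>1 R A X) (\<phi>1 A X)"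
  unfolding \<phi>1_def
  using category.inverse_arrows_inv_arr[OF Fib_category] ind.\<theta>1_iso by (simp add: loc_discrete_simps)

lemma inverse_\<phi>2:
  "f \<in> Hom B A A' \<Longrightarrow> g \<in> Hom B A' A'' \<Longrightarrow> Z \<in> Obj (Fib R A'') \<Longrightarrow>
    inverse_arrows (Fib R A) (\<theta>2 R f g Z) (\<phi>2 f g Z)"
  unfolding \<phi>2_def
  using category.inverse_arrows_inv_arr[OF Fib_category] ind.\<theta>2_iso Hom_base
  by (simp add: Hom1_loc_discrete)

lemma \<phi>1_Hom:
  assumes "A \<in> Obj B" "X \<in> Obj (Fib R A)"
  shows "\<phi>1 A X \<in> Hom (Fib R A) (Ident B A \<triangleright> X) X"
  using inverse_\<phi>1[OF assms] category.inverse_arrows_iff[OF Fib_category \<theta>1_Hom] assms by blast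

lemma \<phi>2_Hom:
  assumes "f \<in> Hom B A A'" "g \<in> Hom B A' A''" "Z \<in> Obj (Fib R A'')"
  shows "\<phi>2 f g Z \<in> Hom (Fib R A) ((g \<cdot>\<^bsub>B\<^esub> f) \<triangleright> Z) (f \<triangleright> g \<triangleright> Z)"
  using inverse_\<phi>2[OF assms] category.inverse_arrows_iff[OF Fib_category \<theta>2_Hom] assms Hom_base
  by blast

lemma \<phi>1_natural:
  assumes A: "A \<in> Obj B" and u: "u \<in> Hom (Fib R A) X X'"
  shows "\<phi>1 A X' \<cdot>\<^bsub>Fib R A\<^esub> (Ident B A \<bullet> u) = u \<cdot>\<^bsub>Fib R A\<^esub> \<phi>1 A X"
proof -
  interpret K: category "Fib R A" using A by (rule Fib_category)
  have X: "X \<in> Obj (Fib R A)" "X' \<in> Obj (Fib R A)"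
    using K.Hom_Obj[OF u] by auto
  have "\<theta>1 R A X' \<cdot>\<^bsub>Fib R A\<^esub> u = (Ident B A \<bullet> u) \<cdot>\<^bsub>Fib R A\<^esub> \<theta>1 R A X"
    using ind.\<theta>1_natural A u by (simp add: loc_discrete_simps)
  then show ?thesis
    using K.inverse_square[OF \<theta>1_Hom[OF A X(1)] \<theta>1_Hom[OF A X(2)] u
        pull_ar_Hom[OF base_cat.Ident_Hom[OF A] u] inverse_\<phi>1[OF A X(1)] inverse_\<phi>1[OF A X(2)]]
    by simp
qed

lemma \<phi>2_natural:
  assumes f: "f \<in> Hom B A A'" and g: "g \<in> Hom B A' A''" and u: "u \<in> Hom (Fib R A'') Z Z'"
  shows "\<phi>2 f g Z' \<cdot>\<^bsub>Fib R A\<^esub> ((g \<cdot>\<^bsub>B\<^esub> f) \<bullet> u) = (f \<bullet> g \<bullet> u) \<cdot>\<^bsub>Fib R A\<^esub> \<phi>2 f g Z"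
proof -
  have "A \<in> Obj B" using Hom_base[OF f] by blast
  then interpret K: category "Fib R A" by (rule Fib_category)
  have "A'' \<in> Obj B" using Hom_base[OF g] by blast
  note Z = category.Hom_Obj[OF Fib_category[OF this] u]
  have "\<theta>2 R f g Z' \<cdot>\<^bsub>Fib R A\<^esub> (f \<bullet> g \<bullet> u) = ((g \<cdot>\<^bsub>B\<^esub> f) \<bullet> u) \<cdot>\<^bsub>Fib R A\<^esub> \<theta>2 R f g Z"
    using ind.\<theta>2_natural f g u by (simp add: loc_discrete_simps Hom1_loc_discrete)
  then show ?thesis
    using K.inverse_square[OF \<theta>2_Hom[OF f g] \<theta>2_Hom[OF f g] pull_ar_Hom[OF f pull_ar_Hom[OF g u]]
        pull_ar_Hom[OF base_cat.Comp_Hom[OF f g] u] inverse_\<phi>2[OF f g] inverse_\<phi>2[OF f g]] Z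
    by simp
qed

text \<open>By \<open>\<theta>_assoc\<close> with a trivial associator, the two ways of composing
  \<open>\<theta>2\<close> along \<open>f\<close>, \<open>g\<close>, \<open>h\<close> are one arrow.
  The two sides here are both inverse to it, hence equal.\<close>

lemma \<phi>_assoc:
  assumes f: "f \<in> Hom B A A'" and g: "g \<in> Hom B A' A''" and h: "h \<in> Hom B A'' A'''"
    and W: "W \<in> Obj (Fib R A''')"
  shows "(f \<bullet> \<phi>2 g h W) \<cdot>\<^bsub>Fib R A\<^esub> \<phi>2 f (h \<cdot>\<^bsub>B\<^esub> g) W =
    \<phi>2 f g (h \<triangleright> W) \<cdot>\<^bsub>Fib R A\<^esub> \<phi>2 (g \<cdot>\<^bsub>B\<^esub> f) h W"
proof -
  have "A \<in> Obj B" using Hom_base[OF f] by blast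
  then interpret K: category "Fib R A" by (rule Fib_category)
  note gf = base_cat.Comp_Hom[OF f g] and hg = base_cat.Comp_Hom[OF g h]
  note hgf = base_cat.Comp_Hom[OF f hg]
  note hW = pull_ob_Obj[OF h W]
  note a = pull_ar_Hom[OF f \<theta>2_Hom[OF g h W]] and b = \<theta>2_Hom[OF f hg W]
  \<comment> \<open>The triple composite stands here for the associator, which in
    \<open>loc_discrete\<close> is represented by that 1-morphism.\<close>
  have "Pull2 R (h \<cdot>\<^bsub>B\<^esub> g \<cdot>\<^bsub>B\<^esub> f) W = Ident (Fib R A) ((h \<cdot>\<^bsub>B\<^esub> g \<cdot>\<^bsub>B\<^esub> f) \<triangleright> W)"
    using Pull2_loc_discrete[OF hgf W] base_cat.Comp_assoc[OF f g h] by simp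
  then have eq: "\<theta>2 R f (h \<cdot>\<^bsub>B\<^esub> g) W \<cdot>\<^bsub>Fib R A\<^esub> (f \<bullet> \<theta>2 R g h W) =
      \<theta>2 R (g \<cdot>\<^bsub>B\<^esub> f) h W \<cdot>\<^bsub>Fib R A\<^esub> \<theta>2 R f g (h \<triangleright> W)"
    using ind.\<theta>_assoc[of f A A' g A'' h A''' W] f g h W
      K.Ident_left[OF K.Comp_Hom[OF a b]] base_cat.Comp_assoc[OF f g h]
    by (simp add: loc_discrete_simps Hom1_loc_discrete)
  show ?thesis
    using K.inverse_arrows_unique[OF K.inverse_arrows_Comp[OF a b
        is_functor.inverse_arrows_ArMap[OF Pull_functor[OF f] inverse_\<phi>2[OF g h W]]
        inverse_\<phi>2[OF f hg W], unfolded eq]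
      K.inverse_arrows_Comp[OF \<theta>2_Hom[OF f g hW] \<theta>2_Hom[OF gf h W]
        inverse_\<phi>2[OF f g hW] inverse_\<phi>2[OF gf h W]]] .
qed

text \<open>The composite of \<open>\<theta>1\<close> and \<open>\<theta>2\<close> is an identity by
  \<open>\<theta>_runit\<close>, and the only inverse of an identity is itself.\<close>

lemma \<phi>_runit:
  assumes f: "f \<in> Hom B A A'" and Y: "Y \<in> Obj (Fib R A')"
  shows "\<phi>1 A (f \<triangleright> Y) \<cdot>\<^bsub>Fib R A\<^esub> \<phi>2 (Ident B A) f Y = Ident (Fib R A) (f \<triangleright> Y)"
proof -
  have A: "A \<in> Obj B" using Hom_base[OF f] by blast
  then interpret K: category "Fib R A" by (rule Fib_category)
  note i = base_cat.Ident_Hom[OF A] and fY = pull_ob_Obj[OF f Y]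
  \<comment> \<open>Units are strict in \<open>B\<close>, so \<open>b\<close> ends at
    \<open>f \<triangleright> Y\<close> and the composite in \<open>eq\<close> is an
    endomorphism.\<close>
  note a = \<theta>1_Hom[OF A fY] and b = \<theta>2_Hom[OF i f Y, unfolded base_cat.Ident_right[OF f]]
  have eq: "\<theta>2 R (Ident B A) f Y \<cdot>\<^bsub>Fib R A\<^esub> \<theta>1 R A (f \<triangleright> Y) = Ident (Fib R A) (f \<triangleright> Y)"
    using ind.\<theta>_runit[of f A A' Y] f Y K.Ident_left[OF K.Comp_Hom[OF a b]] Pull2_loc_discrete[OF f Y]
    by (simp add: loc_discrete_simps Hom1_loc_discrete)
  show ?thesis
    using K.inverse_arrows_unique[OF
        K.inverse_arrows_Comp[OF a b inverse_\<phi>1[OF A fY] inverse_\<phi>2[OF i f Y], unfolded eq]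
        K.inverse_arrows_Ident[OF fY]] .
qed

lemma \<phi>_lunit:
  assumes f: "f \<in> Hom B A A'" and Y: "Y \<in> Obj (Fib R A')"
  shows "(f \<bullet> \<phi>1 A' Y) \<cdot>\<^bsub>Fib R A\<^esub> \<phi>2 f (Ident B A') Y = Ident (Fib R A) (f \<triangleright> Y)"
proof -
  have A: "A \<in> Obj B" and A': "A' \<in> Obj B" using Hom_base[OF f] by auto
  interpret K: category "Fib R A" using A by (rule Fib_category)
  note i = base_cat.Ident_Hom[OF A'] and fY = pull_ob_Obj[OF f Y]
  note a = pull_ar_Hom[OF f \<theta>1_Hom[OF A' Y]]
    and b = \<theta>2_Hom[OF f i Y, unfolded base_cat.Ident_left[OF f]]
  have eq: "\<theta>2 R f (Ident B A') Y \<cdot>\<^bsub>Fib R A\<^esub> (f \<bullet> \<theta>1 R A' Y) = Ident (Fib R A) (f \<triangleright> Y)"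
    using ind.\<theta>_lunit[of f A A' Y] f Y K.Ident_left[OF K.Comp_Hom[OF a b]] Pull2_loc_discrete[OF f Y]
    by (simp add: loc_discrete_simps Hom1_loc_discrete)
  show ?thesis
    using K.inverse_arrows_unique[OF
        K.inverse_arrows_Comp[OF a b
          is_functor.inverse_arrows_ArMap[OF Pull_functor[OF f] inverse_\<phi>1[OF A' Y]]
          inverse_\<phi>2[OF f i Y], unfolded eq]
        K.inverse_arrows_Ident[OF fY]] .
qed

section \<open>Composition laws for the fibre components of lenses\<close>

text \<open>The fibre component of a composite, bracketed as in \<open>Optic\<close>. It serves both
  categories, so their composites can be compared syntactically.\<close>

definition lens_comp where
  "lens_comp f g Z s r =
    r \<cdot>\<^bsub>Fib R (Dom B f)\<^esub> ((f \<bullet> s) \<cdot>\<^bsub>Fib R (Dom B f)\<^esub> \<phi>2 f g Z)"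

lemma lens_comp_Hom:
  assumes f: "f \<in> Hom B A A'" and r: "r \<in> Hom (Fib R A) (f \<triangleright> Y) X"
    and g: "g \<in> Hom B A' A''" and s: "s \<in> Hom (Fib R A') (g \<triangleright> Z) Y"
    and Z: "Z \<in> Obj (Fib R A'')"
  shows "lens_comp f g Z s r \<in> Hom (Fib R A) ((g \<cdot>\<^bsub>B\<^esub> f) \<triangleright> Z) X"
proof -
  have A: "A \<in> Obj B" "Dom B f = A" using Hom_base[OF f] by auto
  interpret K: category "Fib R A" using A(1) by (rule Fib_category)
  show ?thesis
    unfolding lens_comp_def A(2)
    by (rule K.Comp_Hom[OF K.Comp_Hom[OF \<phi>2_Hom[OF f g Z] pull_ar_Hom[OF f s]] r])
qed

lemma lens_comp_Ident_left:
  assumes f: "f \<in> Hom B A A'" and r: "r \<in> Hom (Fib R A) (f \<triangleright> Y) X" and Y: "Y \<in> Obj (Fib R A')"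
  shows "lens_comp f (Ident B A') Y (\<phi>1 A' Y) r = r"
proof -
  have A: "A \<in> Obj B" "Dom B f = A" using Hom_base[OF f] by auto
  interpret K: category "Fib R A" using A(1) by (rule Fib_category)
  show ?thesis
    unfolding lens_comp_def A(2) \<phi>_lunit[OF f Y] by (rule K.Ident_right[OF r])
qed

text \<open>Here \<open>r\<close> sits under the reindexing functor of an identity, which need not
  act as the identity. Naturality of \<open>\<phi>1\<close> brings \<open>r\<close> out, and the
  remaining coherence maps cancel by \<open>\<phi>_runit\<close>.\<close>

lemma lens_comp_Ident_right:
  assumes f: "f \<in> Hom B A A'" and r: "r \<in> Hom (Fib R A) (f \<triangleright> Y) X" and Y: "Y \<in> Obj (Fib R A')"
  shows "lens_comp (Ident B A) f Y r (\<phi>1 A X) = r"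
proof -
  have A: "A \<in> Obj B" using Hom_base[OF f] by auto
  note i = base_cat.Ident_Hom[OF A]
  have dom: "Dom B (Ident B A) = A" using i by (simp add: Hom_def)
  interpret K: category "Fib R A" using A(1) by (rule Fib_category)
  have X: "X \<in> Obj (Fib R A)" using K.Hom_Obj[OF r] by blast
  note fY = pull_ob_Obj[OF f Y]
  have "lens_comp (Ident B A) f Y r (\<phi>1 A X) =
    (\<phi>1 A X \<cdot>\<^bsub>Fib R A\<^esub> (Ident B A \<bullet> r)) \<cdot>\<^bsub>Fib R A\<^esub> \<phi>2 (Ident B A) f Y"
    unfolding lens_comp_def dom
    by (rule K.Comp_assoc[OF \<phi>2_Hom[OF i f Y] pull_ar_Hom[OF i r] \<phi>1_Hom[OF A X], symmetric])
  also have "\<dots> = r \<cdot>\<^bsub>Fib R A\<^esub> (\<phi>1 A (f \<triangleright> Y) \<cdot>\<^bsub>Fib R A\<^esub> \<phi>2 (Ident B A) f Y)"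
    unfolding \<phi>1_natural[OF A r]
    by (rule K.Comp_assoc[OF \<phi>2_Hom[OF i f Y] \<phi>1_Hom[OF A fY] r])
  also have "\<dots> = r"
    unfolding \<phi>_runit[OF f Y] by (rule K.Ident_right[OF r])
  finally show ?thesis .
qed

text \<open>After functoriality splits the reindexing of the inner composite, the two sides differ
  in how they decompose the triple composite and in whether \<open>t\<close> is reindexed in two
  steps or in one. \<open>\<phi>_assoc\<close> settles the first difference,
  \<open>\<phi>2_natural\<close> the second.\<close>

lemma lens_comp_assoc:
  assumes f: "f \<in> Hom B A A'" and r: "r \<in> Hom (Fib R A) (f \<triangleright> Y) X"
    and g: "g \<in> Hom B A' A''" and s: "s \<in> Hom (Fib R A') (g \<triangleright> Z) Y"
    and h: "h \<in> Hom B A'' A'''" and t: "t \<in> Hom (Fib R A'') (h \<triangleright> W) Z"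
    and W: "W \<in> Obj (Fib R A''')"
  shows "lens_comp f (h \<cdot>\<^bsub>B\<^esub> g) W (lens_comp g h W t s) r =
    lens_comp (g \<cdot>\<^bsub>B\<^esub> f) h W t (lens_comp f g Z s r)"
proof -
  note gf = base_cat.Comp_Hom[OF f g] and hg = base_cat.Comp_Hom[OF g h]
  have A: "A \<in> Obj B" "Dom B f = A" "A' \<in> Obj B" "Dom B g = A'" "A'' \<in> Obj B"
    "Dom B (g \<cdot>\<^bsub>B\<^esub> f) = A"
    using Hom_base[OF f] Hom_base[OF g] Hom_base[OF h] Hom_base[OF gf] by auto
  interpret K: category "Fib R A" using A(1) by (rule Fib_category)
  interpret K': category "Fib R A'" using A(3) by (rule Fib_category)
  interpret K'': category "Fib R A''" using A(5) by (rule Fib_category)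
  have Z: "Z \<in> Obj (Fib R A'')" and hW: "h \<triangleright> W \<in> Obj (Fib R A'')" using K''.Hom_Obj[OF t] by auto
  note gt = pull_ar_Hom[OF g t] and fs = pull_ar_Hom[OF f s] and gft = pull_ar_Hom[OF gf t]
  note fgt = pull_ar_Hom[OF f gt]
  note p1 = \<phi>2_Hom[OF g h W] and p2 = \<phi>2_Hom[OF f hg W] and p3 = \<phi>2_Hom[OF f g Z]
    and p4 = \<phi>2_Hom[OF gf h W, folded base_cat.Comp_assoc[OF f g h]]
    and p5 = \<phi>2_Hom[OF f g hW]
  note fp1 = pull_ar_Hom[OF f p1]
  let ?c = "Comp (Fib R A)"
  have "lens_comp f (h \<cdot>\<^bsub>B\<^esub> g) W (lens_comp g h W t s) r =
    ?c r (?c (?c (f \<bullet> s) (?c (f \<bullet> g \<bullet> t) (f \<bullet> \<phi>2 g h W))) (\<phi>2 f (h \<cdot>\<^bsub>B\<^esub> g) W))"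
    unfolding lens_comp_def A
    using pull_ar_Comp[OF f K'.Comp_Hom[OF p1 gt] s] pull_ar_Comp[OF f p1 gt] by simp
  also have "\<dots> = ?c r (?c (f \<bullet> s) (?c (f \<bullet> g \<bullet> t) (?c (f \<bullet> \<phi>2 g h W) (\<phi>2 f (h \<cdot>\<^bsub>B\<^esub> g) W))))"
    using K.Comp_assoc[OF p2 K.Comp_Hom[OF fp1 fgt] fs] K.Comp_assoc[OF p2 fp1 fgt] by simp
  \<comment> \<open>\<open>\<phi>_assoc\<close> replaces one decomposition of the triple composite
    by the other.\<close>
  also have "\<dots> = ?c r (?c (f \<bullet> s) (?c (?c (f \<bullet> g \<bullet> t) (\<phi>2 f g (h \<triangleright> W))) (\<phi>2 (g \<cdot>\<^bsub>B\<^esub> f) h W)))"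
    unfolding \<phi>_assoc[OF f g h W] using K.Comp_assoc[OF p4 p5 fgt] by simp
  \<comment> \<open>Naturality of \<open>\<phi>2\<close>, read from right to left, merges the two
    reindexings of \<open>t\<close> into one along \<open>g \<cdot> f\<close>.\<close>
  also have "\<dots> = ?c r (?c (f \<bullet> s) (?c (\<phi>2 f g Z) (?c ((g \<cdot>\<^bsub>B\<^esub> f) \<bullet> t) (\<phi>2 (g \<cdot>\<^bsub>B\<^esub> f) h W))))"
    unfolding \<phi>2_natural[OF f g t, symmetric] using K.Comp_assoc[OF p4 gft p3] by simp
  also have "\<dots> = ?c (?c r (?c (f \<bullet> s) (\<phi>2 f g Z))) (?c ((g \<cdot>\<^bsub>B\<^esub> f) \<bullet> t) (\<phi>2 (g \<cdot>\<^bsub>B\<^esub> f) h W))"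
    using K.Comp_assoc[OF K.Comp_Hom[OF p4 gft] p3 fs]
      K.Comp_assoc[OF K.Comp_Hom[OF p4 gft] K.Comp_Hom[OF p3 fs] r] by simp
  also have "\<dots> = lens_comp (g \<cdot>\<^bsub>B\<^esub> f) h W t (lens_comp f g Z s r)"
    unfolding lens_comp_def A ..
  finally show ?thesis .
qed

section \<open>The lens category in explicit form\<close>

lemma Lens_simps:
  "Obj (Lens B R) = (SIGMA A:Obj B. Obj (Fib R A))"
  "Dom (Lens B R) = (\<lambda>(P, _, _). P)" "Cod (Lens B R) = (\<lambda>(_, _, Q). Q)"
  "Ident (Lens B R) (A, X) = ((A, X), (Ident B A, \<phi>1 A X), (A, X))"
  by (simp_all add: Lens_def grothendieck_def pointwise_op_def op_cat_def \<phi>1_def)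

lemma Arr_Lens:
  "((A, X), (f, r), (A', Y)) \<in> Arr (Lens B R) \<longleftrightarrow>
    A \<in> Obj B \<and> X \<in> Obj (Fib R A) \<and> A' \<in> Obj B \<and> Y \<in> Obj (Fib R A') \<and>
    f \<in> Hom B A A' \<and> r \<in> Hom (Fib R A) (f \<triangleright> Y) X"
  by (auto simp: Lens_def grothendieck_def pointwise_op_def Hom_op_cat) (simp_all add: op_cat_def)

lemma Hom_LensE:
  assumes "F \<in> Hom (Lens B R) P Q"
  obtains A X f r A' Y where "P = (A, X)" "Q = (A', Y)" "F = ((A, X), (f, r), (A', Y))"
    "X \<in> Obj (Fib R A)" "Y \<in> Obj (Fib R A')" "f \<in> Hom B A A'" "r \<in> Hom (Fib R A) (f \<triangleright> Y) X"
proof -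
  obtain A X f r A' Y where F: "F = ((A, X), (f, r), (A', Y))"
    by (metis prod.collapse)
  with assms have "F \<in> Arr (Lens B R)" "P = (A, X)" "Q = (A', Y)"
    by (auto simp: Hom_def Lens_simps)
  then show thesis using that F Arr_Lens by metis
qed

lemma Hom_LensI:
  "X \<in> Obj (Fib R A) \<Longrightarrow> Y \<in> Obj (Fib R A') \<Longrightarrow> f \<in> Hom B A A' \<Longrightarrow>
    r \<in> Hom (Fib R A) (f \<triangleright> Y) X \<Longrightarrow> ((A, X), (f, r), (A', Y)) \<in> Hom (Lens B R) (A, X) (A', Y)"
  using Hom_base by (auto simp: Hom_def[of "Lens B R"] Arr_Lens Lens_simps)

text \<open>Unfolding \<open>op_cat\<close> reverses both fibre compositions and gives
  \<open>r\<close> after \<open>f \<bullet> s\<close>, bracketed together and preceded by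
  \<open>\<phi>2\<close>. Associativity in the fibre over \<open>A\<close> yields the bracketing of
  \<open>lens_comp\<close>. The inner tags \<open>P\<close> and \<open>Q\<close> are free because
  \<open>Comp\<close> discards them.\<close>

lemma Comp_Lens:
  assumes f: "f \<in> Hom B A A'" and r: "r \<in> Hom (Fib R A) (f \<triangleright> Y) X"
    and g: "g \<in> Hom B A' A''" and s: "s \<in> Hom (Fib R A') (g \<triangleright> Z) Y"
    and Z: "Z \<in> Obj (Fib R A'')"
  shows "(P, (g, s), (A'', Z)) \<cdot>\<^bsub>Lens B R\<^esub> ((A, X), (f, r), Q) =
    ((A, X), (g \<cdot>\<^bsub>B\<^esub> f, lens_comp f g Z s r), (A'', Z))"
proof -
  have A: "A \<in> Obj B" "Dom B f = A" using Hom_base[OF f] by auto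
  interpret K: category "Fib R A" using A(1) by (rule Fib_category)
  show ?thesis
    using K.Comp_assoc[OF \<phi>2_Hom[OF f g Z] pull_ar_Hom[OF f s] r]
    by (simp add: Lens_def grothendieck_def pointwise_op_def op_cat_def lens_comp_def A
        \<phi>2_def[unfolded A])
qed

text \<open>Each equation splits into the corresponding law of \<open>B\<close> on base arrows and
  the \<open>lens_comp\<close> law on fibre arrows.\<close>

lemma category_Lens: "category (Lens B R)"
proof
  show "Dom (Lens B R) F \<in> Obj (Lens B R)" "Cod (Lens B R) F \<in> Obj (Lens B R)"
    if F: "F \<in> Arr (Lens B R)" for F
  proof -
    from HomI[OF F] obtain A X A' Y f where "Dom (Lens B R) F = (A, X)" "Cod (Lens B R) F = (A', Y)"
      "X \<in> Obj (Fib R A)" "Y \<in> Obj (Fib R A')" "f \<in> Hom B A A'"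
      by (rule Hom_LensE)
    then show "Dom (Lens B R) F \<in> Obj (Lens B R)" "Cod (Lens B R) F \<in> Obj (Lens B R)"
      using Hom_base[of f A A'] by (simp_all add: Lens_simps(1))
  qed
next
  fix P assume "P \<in> Obj (Lens B R)"
  then show "Ident (Lens B R) P \<in> Hom (Lens B R) P P"
    using base_cat.Ident_Hom \<phi>1_Hom by (auto simp: Lens_simps intro!: Hom_LensI)
next
  fix F G P Q S assume F: "F \<in> Hom (Lens B R) P Q" and G: "G \<in> Hom (Lens B R) Q S"
  from F obtain A X f r A' Y where P: "P = (A, X)" and Q: "Q = (A', Y)"
    and FE: "F = ((A, X), (f, r), (A', Y))" and f: "X \<in> Obj (Fib R A)" "Y \<in> Obj (Fib R A')"
      "f \<in> Hom B A A'" "r \<in> Hom (Fib R A) (f \<triangleright> Y) X"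
    by (rule Hom_LensE)
  from G obtain g s A'' Z where S: "S = (A'', Z)"
    and GE: "G = ((A', Y), (g, s), (A'', Z))" and g: "Z \<in> Obj (Fib R A'')"
      "g \<in> Hom B A' A''" "s \<in> Hom (Fib R A') (g \<triangleright> Z) Y"
    by (rule Hom_LensE) (auto simp: Q)
  show "G \<cdot>\<^bsub>Lens B R\<^esub> F \<in> Hom (Lens B R) P S"
    unfolding FE GE P S Comp_Lens[OF f(3,4) g(2,3,1)]
    using f g lens_comp_Hom[OF f(3,4) g(2,3,1)] base_cat.Comp_Hom[OF f(3) g(2)]
    by (intro Hom_LensI)
next
  fix F P Q assume "F \<in> Hom (Lens B R) P Q"
  then obtain A X f r A' Y where PQ: "P = (A, X)" "Q = (A', Y)"
    and F: "F = ((A, X), (f, r), (A', Y))" and f: "X \<in> Obj (Fib R A)" "Y \<in> Obj (Fib R A')"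
      "f \<in> Hom B A A'" "r \<in> Hom (Fib R A) (f \<triangleright> Y) X"
    by (rule Hom_LensE)
  have A: "A \<in> Obj B" "A' \<in> Obj B" using Hom_base[OF f(3)] by auto
  show "Ident (Lens B R) Q \<cdot>\<^bsub>Lens B R\<^esub> F = F"
    unfolding PQ F Lens_simps
      Comp_Lens[OF f(3,4) base_cat.Ident_Hom[OF A(2)] \<phi>1_Hom[OF A(2) f(2)] f(2)]
    using lens_comp_Ident_left[OF f(3,4,2)] base_cat.Ident_left[OF f(3)] by simp
  show "F \<cdot>\<^bsub>Lens B R\<^esub> Ident (Lens B R) P = F"
    unfolding PQ F Lens_simps
      Comp_Lens[OF base_cat.Ident_Hom[OF A(1)] \<phi>1_Hom[OF A(1) f(1)] f(3,4,2)]
    using lens_comp_Ident_right[OF f(3,4,2)] base_cat.Ident_right[OF f(3)] by simp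
next
  fix F G H P Q S T
  assume F: "F \<in> Hom (Lens B R) P Q" and G: "G \<in> Hom (Lens B R) Q S" and H: "H \<in> Hom (Lens B R) S T"
  from F obtain A X f r A' Y where Q: "Q = (A', Y)"
    and FE: "F = ((A, X), (f, r), (A', Y))" and f: "X \<in> Obj (Fib R A)" "Y \<in> Obj (Fib R A')"
      "f \<in> Hom B A A'" "r \<in> Hom (Fib R A) (f \<triangleright> Y) X"
    by (rule Hom_LensE)
  from G obtain g s A'' Z where S: "S = (A'', Z)"
    and GE: "G = ((A', Y), (g, s), (A'', Z))" and g: "Z \<in> Obj (Fib R A'')"
      "g \<in> Hom B A' A''" "s \<in> Hom (Fib R A') (g \<triangleright> Z) Y"
    by (rule Hom_LensE) (auto simp: Q)
  from H obtain h t A''' W where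
    HE: "H = ((A'', Z), (h, t), (A''', W))" and h: "W \<in> Obj (Fib R A''')"
      "h \<in> Hom B A'' A'''" "t \<in> Hom (Fib R A'') (h \<triangleright> W) Z"
    by (rule Hom_LensE) (auto simp: S)
  note gf = base_cat.Comp_Hom[OF f(3) g(2)] and hg = base_cat.Comp_Hom[OF g(2) h(2)]
  show "(H \<cdot>\<^bsub>Lens B R\<^esub> G) \<cdot>\<^bsub>Lens B R\<^esub> F = H \<cdot>\<^bsub>Lens B R\<^esub> (G \<cdot>\<^bsub>Lens B R\<^esub> F)"
    unfolding FE GE HE Comp_Lens[OF f(3,4) g(2,3,1)] Comp_Lens[OF g(2,3) h(2,3,1)]
      Comp_Lens[OF f(3,4) hg lens_comp_Hom[OF g(2,3) h(2,3,1)] h(1)]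
      Comp_Lens[OF gf lens_comp_Hom[OF f(3,4) g(2,3,1)] h(2,3,1)]
    using lens_comp_assoc[OF f(3,4) g(2,3) h(2,3,1)] base_cat.Comp_assoc[OF f(3) g(2) h(2)] by simp
qed

section \<open>Optics over a locally discrete base\<close>

abbreviation "Opt \<equiv> Optic (loc_discrete B) trivial_indexed R"

text \<open>A generator along \<open>\<alpha>\<close> has \<open>c = d = \<alpha>\<close>, and its
  two sides are literally the same pair \<open>(f, act f f x)\<close> with
  \<open>f = \<alpha>\<close>. This holds for arbitrary \<open>P\<close> and
  \<open>act\<close>.\<close>

lemma coend_rel_homcat: "coend_rel (homcat (loc_discrete B) A A') P act = Id"
proof -
  have "Ident (homcat (loc_discrete B) A A') f = f" for f
    by (simp add: homcat_def full_subcat_def loc_discrete_simps discrete_cat_def)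
  then have "coend_gen (homcat (loc_discrete B) A A') P act \<subseteq> Id"
    by (auto simp: coend_gen_def Hom_homcat_loc_discrete)
  then have "coend_rel (homcat (loc_discrete B) A A') P act \<subseteq> Id\<^sup>*"
    unfolding coend_rel_def by (intro rtrancl_mono) blast
  then show ?thesis
    by (auto simp: coend_rel_def)
qed

lemma optic_class_eq: "optic_class (loc_discrete B) L S P Q f l r = {(f, l, r)}"
  by (simp add: optic_class_def coend_inj_def coend_rel_homcat)

lemma optic_hom_eq:
  "optic_hom (loc_discrete B) trivial_indexed R (A, (), X) (A', (), Y) =
    {{(f, (), r)} | f r. f \<in> Hom B A A' \<and> r \<in> Hom (Fib R A) (f \<triangleright> Y) X}"
proof -
  have "Obj (homcat (loc_discrete B) A A') = Hom B A A'"
    by (auto simp: homcat_def full_subcat_def Hom1_loc_discrete loc_discrete_simps discrete_cat_def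
        Hom_def)
  then show ?thesis
    by (auto simp: optic_hom_def coend_def coend_rel_homcat optic_val_def quotient_def
        trivial_indexed_def Hom_discrete_cat)
qed

lemma Optic_simps:
  "Obj Opt = (SIGMA A:Obj B. UNIV \<times> Obj (Fib R A))"
  "Dom Opt = (\<lambda>(P, _, _). P)" "Cod Opt = (\<lambda>(_, _, Q). Q)"
  "Ident Opt (A, (), X) = ((A, (), X), {(Ident B A, (), \<phi>1 A X)}, (A, (), X))"
  by (simp_all add: Optic_def trivial_indexed_def discrete_cat_def loc_discrete_simps
      optic_class_eq \<phi>1_def)

lemma Arr_Optic:
  "((A, (), X), c, (A', (), Y)) \<in> Arr Opt \<longleftrightarrow>
    A \<in> Obj B \<and> X \<in> Obj (Fib R A) \<and> A' \<in> Obj B \<and> Y \<in> Obj (Fib R A') \<and>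
    c \<in> optic_hom (loc_discrete B) trivial_indexed R (A, (), X) (A', (), Y)"
  by (simp add: Optic_def trivial_indexed_def discrete_cat_def loc_discrete_simps)

lemma Hom_OpticE:
  assumes "F \<in> Hom Opt P Q"
  obtains A X f r A' Y where "P = (A, (), X)" "Q = (A', (), Y)"
    "F = ((A, (), X), {(f, (), r)}, (A', (), Y))"
    "X \<in> Obj (Fib R A)" "Y \<in> Obj (Fib R A')" "f \<in> Hom B A A'" "r \<in> Hom (Fib R A) (f \<triangleright> Y) X"
proof -
  obtain A X c A' Y where F: "F = ((A, (), X), c, (A', (), Y))"
    by (metis prod.collapse old.unit.exhaust)
  then have "X \<in> Obj (Fib R A)" "Y \<in> Obj (Fib R A')" "P = (A, (), X)" "Q = (A', (), Y)"
    "c \<in> optic_hom (loc_discrete B) trivial_indexed R (A, (), X) (A', (), Y)"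
    using assms unfolding Hom_def by (auto simp: Optic_simps Arr_Optic)
  then show thesis using that unfolding F optic_hom_eq by blast
qed

lemma Hom_OpticI:
  "X \<in> Obj (Fib R A) \<Longrightarrow> Y \<in> Obj (Fib R A') \<Longrightarrow> f \<in> Hom B A A' \<Longrightarrow>
    r \<in> Hom (Fib R A) (f \<triangleright> Y) X \<Longrightarrow>
    ((A, (), X), {(f, (), r)}, (A', (), Y)) \<in> Hom Opt (A, (), X) (A', (), Y)"
  using Hom_base[of f A A'] by (auto simp: Hom_def[of Opt] Arr_Optic optic_hom_eq Optic_simps)

text \<open>The unions over representatives range over singletons and collapse to one class, and the
  left component has type \<open>unit\<close>. The hypothesis on \<open>f\<close> identifies the
  fibre over \<open>A\<close> with the one over \<open>Dom B f\<close> used in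
  \<open>lens_comp\<close>.\<close>

lemma Comp_Optic:
  assumes "f \<in> Hom B A A'"
  shows "(P, {(g, (), s)}, (A'', (), Z)) \<cdot>\<^bsub>Opt\<^esub> ((A, (), X), {(f, (), r)}, Q) =
    ((A, (), X), {(g \<cdot>\<^bsub>B\<^esub> f, (), lens_comp f g Z s r)}, (A'', (), Z))"
  using Hom_base[OF assms]
  by (simp add: Optic_def loc_discrete_simps optic_class_eq lens_comp_def \<phi>2_def)

section \<open>The comparison of optics with lenses\<close>

text \<open>\<open>the_elem\<close> selects the representative; on arrows of \<open>Opt\<close> it
  is meaningful because their classes are singletons.\<close>

definition optic_to_lens ::
  "('o \<times> unit \<times> 'y, ('o \<times> unit \<times> 'y) \<times> ('m \<times> unit \<times> 'b) set \<times> ('o \<times> unit \<times> 'y),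
    'o \<times> 'y, ('o \<times> 'y) \<times> ('m \<times> 'b) \<times> ('o \<times> 'y)) functr" where
  "optic_to_lens = \<lparr>ObMap = (\<lambda>(A, _, X). (A, X)),
     ArMap = (\<lambda>((A, _, X), c, (A', _, Y)).
       ((A, X), (case the_elem c of (f, _, r) \<Rightarrow> (f, r)), (A', Y)))\<rparr>"

lemma optic_to_lens_simps:
  "ObMap optic_to_lens (A, (), X) = (A, X)"
  "ArMap optic_to_lens ((A, (), X), {(f, (), r)}, (A', (), Y)) = ((A, X), (f, r), (A', Y))"
  by (simp_all add: optic_to_lens_def)

lemma is_cat_iso_optic_to_lens: "is_cat_iso Opt (Lens B R) optic_to_lens"
proof -
  have ob: "bij_betw (ObMap optic_to_lens) (Obj Opt) (Obj (Lens B R))"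
    by (rule bij_betw_byWitness[where f' = "\<lambda>(A, X). (A, (), X)"])
      (auto simp: Optic_simps Lens_simps optic_to_lens_simps)
  \<comment> \<open>Arrows on both sides carry their endpoints, so equal images determine the
    objects as well as \<open>f\<close> and \<open>r\<close>.\<close>
  have inj: "inj_on (ArMap optic_to_lens) (Arr Opt)"
  proof (rule inj_onI)
    fix F G assume F: "F \<in> Arr Opt" and G: "G \<in> Arr Opt"
      and eq: "ArMap optic_to_lens F = ArMap optic_to_lens G"
    from HomI[OF F] obtain A X f r A' Y where "F = ((A, (), X), {(f, (), r)}, (A', (), Y))"
      by (rule Hom_OpticE)
    moreover from HomI[OF G] obtain C U g s C' V where "G = ((C, (), U), {(g, (), s)}, (C', (), V))"
      by (rule Hom_OpticE)
    ultimately show "F = G"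
      using eq by (simp add: optic_to_lens_simps)
  qed
  have Hom: "ArMap optic_to_lens F \<in> Hom (Lens B R) (ObMap optic_to_lens P) (ObMap optic_to_lens Q)"
    "P \<in> Obj Opt" "Q \<in> Obj Opt" if F: "F \<in> Hom Opt P Q" for F P Q
  proof -
    from F obtain A X f r A' Y where PQ: "P = (A, (), X)" "Q = (A', (), Y)"
      and FE: "F = ((A, (), X), {(f, (), r)}, (A', (), Y))"
      and f: "X \<in> Obj (Fib R A)" "Y \<in> Obj (Fib R A')" "f \<in> Hom B A A'"
        "r \<in> Hom (Fib R A) (f \<triangleright> Y) X"
      by (rule Hom_OpticE)
    show "ArMap optic_to_lens F \<in> Hom (Lens B R) (ObMap optic_to_lens P) (ObMap optic_to_lens Q)"
      unfolding PQ FE optic_to_lens_simps by (rule Hom_LensI[OF f])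
    show "P \<in> Obj Opt" "Q \<in> Obj Opt"
      using PQ f Hom_base[OF f(3)] by (simp_all add: Optic_simps)
  qed
  have surj: "ArMap optic_to_lens ` Arr Opt = Arr (Lens B R)"
  proof
    show "ArMap optic_to_lens ` Arr Opt \<subseteq> Arr (Lens B R)"
    proof
      fix G assume "G \<in> ArMap optic_to_lens ` Arr Opt"
      then obtain F where F: "F \<in> Arr Opt" and G: "G = ArMap optic_to_lens F" by blast
      show "G \<in> Arr (Lens B R)"
        unfolding G using Hom(1)[OF HomI[OF F]] unfolding Hom_def by blast
    qed
    show "Arr (Lens B R) \<subseteq> ArMap optic_to_lens ` Arr Opt"
    proof
      fix F assume "F \<in> Arr (Lens B R)"
      then obtain A X f r A' Y where F: "F = ((A, X), (f, r), (A', Y))"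
        "X \<in> Obj (Fib R A)" "Y \<in> Obj (Fib R A')" "f \<in> Hom B A A'" "r \<in> Hom (Fib R A) (f \<triangleright> Y) X"
        by (rule Hom_LensE[OF HomI])
      then have "((A, (), X), {(f, (), r)}, (A', (), Y)) \<in> Arr Opt"
        using Hom_OpticI[of X A Y A' f r] by (simp add: Hom_def[of Opt])
      then show "F \<in> ArMap optic_to_lens ` Arr Opt"
        unfolding F(1) optic_to_lens_simps(2)[symmetric] by (rule imageI)
    qed
  qed
  have "is_functor Opt (Lens B R) optic_to_lens"
  \<comment> \<open>This also supplies the category laws for \<open>Opt\<close>.\<close>
  proof (rule category_transport[OF category_Lens inj bij_betw_imp_inj_on[OF ob]])
    show "ObMap optic_to_lens P \<in> Obj (Lens B R)" if "P \<in> Obj Opt" for P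
      using bij_betwE[OF ob] that by blast
    show "ArMap optic_to_lens F \<in> Arr (Lens B R) \<and> Dom Opt F \<in> Obj Opt \<and> Cod Opt F \<in> Obj Opt \<and>
      Dom (Lens B R) (ArMap optic_to_lens F) = ObMap optic_to_lens (Dom Opt F) \<and>
      Cod (Lens B R) (ArMap optic_to_lens F) = ObMap optic_to_lens (Cod Opt F)"
      if "F \<in> Arr Opt" for F
      using Hom[OF HomI[OF that]] by (simp add: Hom_def)
    show "Ident Opt P \<in> Hom Opt P P \<and>
      ArMap optic_to_lens (Ident Opt P) = Ident (Lens B R) (ObMap optic_to_lens P)"
      if "P \<in> Obj Opt" for P
      using that base_cat.Ident_Hom \<phi>1_Hom
      by (auto simp: Optic_simps Lens_simps optic_to_lens_simps intro!: Hom_OpticI)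
    fix F G P Q S assume F: "F \<in> Hom Opt P Q" and G: "G \<in> Hom Opt Q S"
    from F obtain A X f r A' Y where P: "P = (A, (), X)" and Q: "Q = (A', (), Y)"
      and FE: "F = ((A, (), X), {(f, (), r)}, (A', (), Y))"
      and f: "X \<in> Obj (Fib R A)" "f \<in> Hom B A A'" "r \<in> Hom (Fib R A) (f \<triangleright> Y) X"
      by (rule Hom_OpticE)
    from G obtain g s A'' Z where S: "S = (A'', (), Z)"
      and GE: "G = ((A', (), Y), {(g, (), s)}, (A'', (), Z))" and g: "Z \<in> Obj (Fib R A'')"
        "g \<in> Hom B A' A''" "s \<in> Hom (Fib R A') (g \<triangleright> Z) Y"
      by (rule Hom_OpticE) (auto simp: Q)
    \<comment> \<open>Once both composites are rewritten through \<open>lens_comp\<close>, the two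
      sides of the equation are identical and only membership in the hom-set remains.\<close>
    show "G \<cdot>\<^bsub>Opt\<^esub> F \<in> Hom Opt P S \<and>
      ArMap optic_to_lens (G \<cdot>\<^bsub>Opt\<^esub> F) =
        ArMap optic_to_lens G \<cdot>\<^bsub>Lens B R\<^esub> ArMap optic_to_lens F"
      unfolding FE GE P S Comp_Optic[OF f(2)] optic_to_lens_simps Comp_Lens[OF f(2,3) g(2,3,1)]
      using Hom_OpticI[OF f(1) g(1) base_cat.Comp_Hom[OF f(2) g(2)]
          lens_comp_Hom[OF f(2,3) g(2,3,1)]] by blast
  qed
  then show ?thesis
    using ob inj surj by (intro is_functor.is_cat_iso_if_bij) (auto simp: bij_betw_def)
qed

end

text \<open>The extra conjuncts make the isomorphism the expected one: it forgets the trivial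
  component and sends the class of \<open>((), r)\<close> with representative \<open>f\<close> to
  the lens \<open>(f, r)\<close>.\<close>

theorem proposition2:
  fixes B :: "('o, 'm) cat"
    and R :: "('o, 'm, 'm, 'y, 'b) indexed_cat"
  assumes "category B"
    and "indexed_category (loc_discrete B) R"
  shows "\<exists>F. is_cat_iso (Optic (loc_discrete B) trivial_indexed R) (Lens B R) F \<and>
    (\<forall>A \<in> Obj B. \<forall>X' \<in> Obj (Fib R A). ObMap F (A, (), X') = (A, X')) \<and>
    (\<forall>A \<in> Obj B. \<forall>X' \<in> Obj (Fib R A). \<forall>A' \<in> Obj B. \<forall>Y' \<in> Obj (Fib R A').
      \<forall>f \<in> Hom B A A'. \<forall>r \<in> Hom (Fib R A) (ObMap (Pull R f) Y') X'.
        ArMap F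
          ((A, (), X'),
           optic_class (loc_discrete B) trivial_indexed R (A, (), X') (A', (), Y') f () r,
           (A', (), Y')) =
        ((A, X'), (f, r), (A', Y')))"
proof -
  interpret indexed_category_over_category B R
    using assms by (rule indexed_category_over_category.intro)
  show ?thesis
    using is_cat_iso_optic_to_lens
    by (intro exI[of _ optic_to_lens]) (simp add: optic_class_eq optic_to_lens_simps)
qed

end
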